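(* Consider the regularized MPC closed loop described in the context. Assume that $D$ is positive definite and that the regularizer has the form $V_{\mathrm{reg}}(U,t)=\sum_{h=1}^{H}\ell_{\mathrm{reg}}(u_h,t+h)$, where $\ell_{\mathrm{reg}}(\cdot,t):\mathbb{R}^m\to\mathbb{R}$ is convex and $L$-smooth for each $t\in\mathbb{N}$ ($L>0$). Let $\eta\in(0,1)$. For a symmetric matrix $P\in\mathbb{R}^{n\times n}$ and scalars $\lambda_1,\dots,\lambda_H$, $L$, put $\Lambda:=\mathrm{diag}(\lambda_1,\dots,\lambda_H)\otimes I_m$ and consider the matrix inequality $$ (\ast)\quad \begin{bmatrix} A^\top P A-\eta^2 P & A^\top P B\Pi_1\\ \Pi_1^\top B^\top P A & \Pi_1^\top B^\top P B\Pi_1\end{bmatrix} +\begin{bmatrix}0 & I_{Hm}\\ -C & -D\end{bmatrix}^\top \begin{bmatrix}0&\Lambda\\ \Lambda&-\tfrac{2}{L}\Lambda\end{bmatrix} \begin{bmatrix}0 & I_{Hm}\\ -C & -D\end{bmatrix}\preceq 0 . $$ If there exist a positive definite matrix $P$ and nonnegative scalars $\lambda_1,\dots,\lambda_H$ satisfying $(\ast)$, with $L$ the smoothness constant above, then the closed-loop system is strongly contracting with respect to the norm $\|\cdot\|_P$ with factor $\eta$. Furthermore, suppose $A_{\mathrm{nom}}:=A-B\Pi_1D^{-1}C$ is Schur. Then, for any $\eta\in(\rho(A_{\mathrm{nom}}),1)$, there exist a positive definite matrix $P$, nonnegative scalars $\lambda_1,\dots,\lambda_H$, and a positive scalar $L$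 satisfying $(\ast)$.
   Context: Plant: $x(t+1)=Ax(t)+Bu(t)$, $t\in\mathbb{N}=\{0,1,2,\dots\}$, with $A\in\mathbb{R}^{n\times n}$, $B\in\mathbb{R}^{n\times m}$. Let $H\ge 1$ be an integer (prediction horizon), and let $Q,Q_{\mathrm f}\in\mathbb{R}^{n\times n}$, $R\in\mathbb{R}^{m\times m}$ be symmetric cost matrices; write $\|v\|_Q^2=v^\top Qv$ (similarly for the others). For a state $x$ and time $t$, the optimal control problem (OCP) is: minimize over $U=[u_1;\dots;u_H]\in\mathbb{R}^{Hm}$ (each $u_h\in\mathbb{R}^m$) $$\tfrac12\sum_{h=1}^{H}(\|x_h\|_Q^2+\|u_h\|_R^2)+\tfrac12\|x_{H+1}\|_{Q_{\mathrm f}}^2+V_{\mathrm{reg}}(X,U,t),$$ where $x_1=x$, $x_{h+1}=Ax_h+Bu_h$ for $h=1,\dots,H$, and $X=[x_2;\dots;x_{H+1}]\in\mathbb{R}^{Hn}$; here the regularizer $V_{\mathrm{reg}}$ depends only on $U,t$. Define $\bar A:=[A;A^2;\dots;A^H]\in\mathbb{R}^{Hn\times n}$ (vertical stacking); $\bar B\in\mathbb{R}^{Hn\times Hm}$ the block lower triangular matrix whose $(i,j)$ block is $A^{i-j}B$ for $i\ge j$ and $0$ for $i<j$; $\bar Q:=\mathrm{diag}(Q,\dots,Q,Q_{\mathrm f})$ with $H-1$ copies of $Q$; $\bar R:=\mathrm{diag}(R,\dots,R)$ with $H$ copies; $C:=\bar B^\top\bar Q\bar A$; $D:=\bar R+\bar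 B^\top\bar Q\bar B$. Up to terms independent of $U$, the OCP is $\min_U\ U^\top Cx+\tfrac12U^\top DU+V_{\mathrm{reg}}(\bar Ax+\bar BU,U,t)$. Let $U_t^\ast(x)$ be the optimal solution (unique under the stated assumptions) and $\Pi_1=[I_m\ 0]\in\mathbb{R}^{m\times Hm}$. The regularized MPC feedback is $u(t)=\Pi_1U_t^\ast(x(t))$; the closed loop is $x(t+1)=Ax(t)+B\Pi_1U^\ast_t(x(t))$. A function is $L$-smooth if it is differentiable with gradient Lipschitz with constant $L$ (Euclidean norm). A system $x(t+1)=f_t(x(t))$ is strongly contracting with respect to $\|\cdot\|_P$ ($\|v\|_P=\sqrt{v^\top Pv}$, $P$ positive definite) with factor $\eta\in(0,1)$ if any two trajectories satisfy $\|x^{(1)}(t+1)-x^{(2)}(t+1)\|_P\le\eta\|x^{(1)}(t)-x^{(2)}(t)\|_P$ for all $t\in\mathbb{N}$. $\rho(\cdot)$ is the spectral radius; a matrix is Schur if its spectral radius is less than 1. Positive definite matrices are symmetric; $\otimes$ is the Kronecker product. *)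

theory Defs
  imports "HOL-Analysis.Analysis"
begin

definition sym_matrix :: "real^'n^'n \<Rightarrow> bool" where
  "sym_matrix M \<longleftrightarrow> transpose M = M"

definition pos_def :: "real^'n^'n \<Rightarrow> bool" where
  "pos_def M \<longleftrightarrow> sym_matrix M \<and> (\<forall>v. v \<noteq> 0 \<longrightarrow> 0 < v \<bullet> (M *v v))"

definition neg_semidef :: "real^'n^'n \<Rightarrow> bool" where
  "neg_semidef M \<longleftrightarrow> sym_matrix M \<and> (\<forall>v. v \<bullet> (M *v v) \<le> 0)"

definition sq_norm :: "real^'n^'n \<Rightarrow> real^'n \<Rightarrow> real" where
  "sq_norm M v = v \<bullet> (M *v v)"

definition weighted_norm :: "real^'n^'n \<Rightarrow> real^'n \<Rightarrow> real" where
  "weighted_norm P v = sqrt (sq_norm P v)"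

(* The library's power on vectors is componentwise, so matrix powers need their own name. *)
definition matrix_pow :: "real^'n^'n \<Rightarrow> nat \<Rightarrow> real^'n^'n" where
  "matrix_pow A k = (((**) A) ^^ k) (mat 1)"

definition complex_eigenvalues :: "real^'n^'n \<Rightarrow> complex set" where
  "complex_eigenvalues A =
     {z. \<exists>v :: complex^'n. v \<noteq> 0 \<and> (\<chi> i j. complex_of_real (A $ i $ j)) *v v = z *s v}"

definition spec_radius :: "real^'n^'n \<Rightarrow> real" where
  "spec_radius A = Max (cmod ` complex_eigenvalues A)"

definition schur_stable :: "real^'n^'n \<Rightarrow> bool" where
  "schur_stable A \<longleftrightarrow> spec_radius A < 1"

definition kron :: "real^'b^'a \<Rightarrow> real^'d^'c \<Rightarrow> real^('b \<times> 'd)^('a \<times> 'c)" where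
  "kron M N = (\<chi> p q. M $ fst p $ fst q * N $ snd p $ snd q)"

definition diag_matrix :: "real^'n \<Rightarrow> real^'n^'n" where
  "diag_matrix d = (\<chi> i j. if i = j then d $ i else 0)"

definition block_diag :: "('h::finite \<Rightarrow> real^'n^'n) \<Rightarrow> real^('h \<times> 'n)^('h \<times> 'n)" where
  "block_diag F = (\<chi> p q. if fst p = fst q then F (fst p) $ snd p $ snd q else 0)"

definition block2 ::
  "real^'c^'a \<Rightarrow> real^'d^'a \<Rightarrow> real^'c^'b \<Rightarrow> real^'d^'b \<Rightarrow> real^('c + 'd)^('a + 'b)" where
  "block2 M11 M12 M21 M22 = (\<chi> p q.
     case p of
       Inl i \<Rightarrow> (case q of Inl j \<Rightarrow> M11 $ i $ j | Inr j \<Rightarrow> M12 $ i $ j)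
     | Inr i \<Rightarrow> (case q of Inl j \<Rightarrow> M21 $ i $ j | Inr j \<Rightarrow> M22 $ i $ j))"

definition L_smooth :: "real \<Rightarrow> ('a::real_inner \<Rightarrow> real) \<Rightarrow> bool" where
  "L_smooth L f \<longleftrightarrow> (\<exists>g. (\<forall>x. GDERIV f x :> g x) \<and> L-lipschitz_on UNIV g)"

definition trajectory :: "(nat \<Rightarrow> 'a \<Rightarrow> 'a) \<Rightarrow> (nat \<Rightarrow> 'a) \<Rightarrow> bool" where
  "trajectory f x \<longleftrightarrow> (\<forall>t. x (Suc t) = f t (x t))"

definition strongly_contracting ::
  "(nat \<Rightarrow> real^'n \<Rightarrow> real^'n) \<Rightarrow> real^'n^'n \<Rightarrow> real \<Rightarrow> bool" where
  "strongly_contracting f P \<eta> \<longleftrightarrow> pos_def P \<and> 0 < \<eta> \<and> \<eta> < 1 \<and>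
     (\<forall>x y. trajectory f x \<longrightarrow> trajectory f y \<longrightarrow>
       (\<forall>t. weighted_norm P (x (Suc t) - y (Suc t)) \<le> \<eta> * weighted_norm P (x t - y t)))"

(* A horizon of length H is a finite linearly ordered type 'h with CARD('h) = H; every H >= 1 is
   the cardinality of such a type, e.g. of a numeral type.  The element h of 'h stands for
   the number idx h in {1..H}, and stage is the inverse of idx.  Stacked vectors and block
   matrices are indexed by pairs (block, position within the block). *)

definition idx :: "'h::{finite,linorder} \<Rightarrow> nat" where
  "idx h = card {..h}"

definition stage :: "nat \<Rightarrow> 'h::{finite,linorder}" where
  "stage = the_inv idx"

lemma idx_strict_mono: "h < k \<Longrightarrow> idx h < idx k" for h k :: "'h::{finite,linorder}"
  unfolding idx_def by (intro psubset_card_mono) auto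

lemma inj_idx: "inj (idx :: 'h::{finite,linorder} \<Rightarrow> nat)"
  by (metis (mono_tags, lifting) idx_strict_mono injI less_irrefl_nat linorder_neqE)

lemma bij_betw_idx: "bij_betw (idx :: 'h::{finite,linorder} \<Rightarrow> nat) UNIV {1..CARD('h)}"
proof -
  have "range (idx :: 'h \<Rightarrow> nat) \<subseteq> {1..CARD('h)}"
  proof (clarsimp simp: idx_def, intro conjI)
    fix h :: 'h
    have "{..h} \<noteq> {}" by blast
    then show "Suc 0 \<le> card {..h}"
      by (simp add: Suc_le_eq card_gt_0_iff)
    show "card {..h} \<le> CARD('h)"
      by (rule card_mono) simp_all
  qed
  moreover have "card (range (idx :: 'h \<Rightarrow> nat)) = card {1..CARD('h)}"
    by (simp add: card_image inj_idx)
  ultimately have "range (idx :: 'h \<Rightarrow> nat) = {1..CARD('h)}"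
    by (intro card_subset_eq) auto
  then show ?thesis
    by (simp add: bij_betw_def inj_idx)
qed

lemma stage_idx: "stage (idx h) = h" for h :: "'h::{finite,linorder}"
  by (simp add: stage_def the_inv_f_f inj_idx)

definition blk :: "real^('h::finite \<times> 'm::finite) \<Rightarrow> 'h \<Rightarrow> real^'m" where
  "blk U h = (\<chi> i. U $ (h, i))"

(* pred_state A B x U k is x_k for 1 <= k <= H + 1; the value at k = 0 is never used. *)
primrec pred_state ::
  "real^'n^'n \<Rightarrow> real^'m^'n \<Rightarrow> real^'n \<Rightarrow> real^('h::{finite,linorder} \<times> 'm) \<Rightarrow> nat \<Rightarrow> real^'n" where
  "pred_state A B x U 0 = x"
| "pred_state A B x U (Suc k) =
     (if k = 0 then x else A *v pred_state A B x U k + B *v blk U (stage k))"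

definition ocp_cost ::
  "real^'n^'n \<Rightarrow> real^'m^'n \<Rightarrow> real^'n^'n \<Rightarrow> real^'n^'n \<Rightarrow> real^'m^'m \<Rightarrow>
   (real^('h::{finite,linorder} \<times> 'm) \<Rightarrow> nat \<Rightarrow> real) \<Rightarrow>
   nat \<Rightarrow> real^'n \<Rightarrow> real^('h \<times> 'm) \<Rightarrow> real" where
  "ocp_cost A B Q Qf R Vreg t x U =
     1/2 * (\<Sum>h\<in>(UNIV::'h set). sq_norm Q (pred_state A B x U (idx h)) + sq_norm R (blk U h))
     + 1/2 * sq_norm Qf (pred_state A B x U (CARD('h) + 1))
     + Vreg U t"

definition separable_reg ::
  "(real^'m \<Rightarrow> nat \<Rightarrow> real) \<Rightarrow> real^('h::{finite,linorder} \<times> 'm) \<Rightarrow> nat \<Rightarrow> real" where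
  "separable_reg l U t = (\<Sum>h\<in>(UNIV::'h set). l (blk U h) (t + idx h))"

(* The definite description refers to the unique global minimizer; without existence and
   uniqueness nothing is known about its value. *)
definition ocp_solution ::
  "real^'n^'n \<Rightarrow> real^'m^'n \<Rightarrow> real^'n^'n \<Rightarrow> real^'n^'n \<Rightarrow> real^'m^'m \<Rightarrow>
   (real^('h::{finite,linorder} \<times> 'm) \<Rightarrow> nat \<Rightarrow> real) \<Rightarrow>
   nat \<Rightarrow> real^'n \<Rightarrow> real^('h \<times> 'm)" where
  "ocp_solution A B Q Qf R Vreg t x =
     (THE U. is_arg_min (ocp_cost A B Q Qf R Vreg t x) (\<lambda>_. True) U)"

(* The selector [I_m 0] of the first input block. *)
definition Pi1 :: "real^('h::{finite,linorder} \<times> 'm)^'m" where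
  "Pi1 = (\<chi> i q. if idx (fst q) = 1 \<and> snd q = i then 1 else 0)"

definition mpc_closed_loop ::
  "real^'n^'n \<Rightarrow> real^'m^'n \<Rightarrow> real^'n^'n \<Rightarrow> real^'n^'n \<Rightarrow> real^'m^'m \<Rightarrow>
   (real^('h::{finite,linorder} \<times> 'm) \<Rightarrow> nat \<Rightarrow> real) \<Rightarrow> nat \<Rightarrow> real^'n \<Rightarrow> real^'n" where
  "mpc_closed_loop A B Q Qf R Vreg t x =
     A *v x + B *v (Pi1 *v ocp_solution A B Q Qf R Vreg t x)"

definition Abar :: "real^'n^'n \<Rightarrow> real^'n^('h::{finite,linorder} \<times> 'n)" where
  "Abar A = (\<chi> p j. matrix_pow A (idx (fst p)) $ snd p $ j)"

definition Bbar ::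
  "real^'n^'n \<Rightarrow> real^'m^'n \<Rightarrow> real^('h::{finite,linorder} \<times> 'm)^('h \<times> 'n)" where
  "Bbar A B = (\<chi> p q. if fst q \<le> fst p
     then (matrix_pow A (idx (fst p) - idx (fst q)) ** B) $ snd p $ snd q else 0)"

definition Qbar ::
  "real^'n^'n \<Rightarrow> real^'n^'n \<Rightarrow> real^('h::{finite,linorder} \<times> 'n)^('h \<times> 'n)" where
  "Qbar Q Qf = block_diag (\<lambda>h. if idx h = CARD('h) then Qf else Q)"

definition Rbar :: "real^'m^'m \<Rightarrow> real^('h::{finite,linorder} \<times> 'm)^('h \<times> 'm)" where
  "Rbar R = block_diag (\<lambda>_. R)"

definition Cmat ::
  "real^'n^'n \<Rightarrow> real^'m^'n \<Rightarrow> real^'n^'n \<Rightarrow> real^'n^'n \<Rightarrow>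
   real^'n^('h::{finite,linorder} \<times> 'm)" where
  "Cmat A B Q Qf =
     transpose (Bbar A B :: real^('h \<times> 'm)^('h \<times> 'n)) ** Qbar Q Qf ** Abar A"

definition Dmat ::
  "real^'n^'n \<Rightarrow> real^'m^'n \<Rightarrow> real^'n^'n \<Rightarrow> real^'n^'n \<Rightarrow> real^'m^'m \<Rightarrow>
   real^('h::{finite,linorder} \<times> 'm)^('h \<times> 'm)" where
  "Dmat A B Q Qf R =
     Rbar R + transpose (Bbar A B :: real^('h \<times> 'm)^('h \<times> 'n)) ** Qbar Q Qf ** Bbar A B"

definition A_nom ::
  "real^'n^'n \<Rightarrow> real^'m^'n \<Rightarrow> real^'n^('h::{finite,linorder} \<times> 'm) \<Rightarrow>
   real^('h \<times> 'm)^('h \<times> 'm) \<Rightarrow> real^'n^'n" where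
  "A_nom A B C D = A - B ** Pi1 ** matrix_inv D ** C"

definition Lambda :: "real^'h \<Rightarrow> real^('h \<times> 'm::finite)^('h \<times> 'm)" where
  "Lambda l = kron (diag_matrix l) (mat 1)"

definition mpc_lmi ::
  "real^'n^'n \<Rightarrow> real^'m^'n \<Rightarrow> real^'n^('h::{finite,linorder} \<times> 'm) \<Rightarrow>
   real^('h \<times> 'm)^('h \<times> 'm) \<Rightarrow> real \<Rightarrow> real^'n^'n \<Rightarrow> real^('h::{finite,linorder}) \<Rightarrow> real \<Rightarrow> bool" where
  "mpc_lmi A B C D \<eta> P l L \<longleftrightarrow>
     (let BP = B ** (Pi1 :: real^('h \<times> 'm)^'m);
          M = block2 0 (mat 1) (- C) (- D)
      in neg_semidef
           (block2 (transpose A ** P ** A - \<eta>\<^sup>2 *\<^sub>R P) (transpose A ** P ** BP)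
                   (transpose BP ** P ** A) (transpose BP ** P ** BP)
            + transpose M ** block2 0 (Lambda l) (Lambda l) (- (2 / L) *\<^sub>R Lambda l) ** M))"

end

theory Submission
  imports Defs "HOL-Complex_Analysis.Conformal_Mappings"
begin

text \<open>
The cost of the control problem is, up to a term independent of the inputs, the strongly convex
quadratic \<open>U \<bullet> C x + 1/2 U \<bullet> D U\<close> plus a sum of convex functions of the single inputs
(\<open>ocp_cost_eq\<close>). Such a program has exactly one minimizer \<open>U\<close>, and at it the affine
expression \<open>y = - C x - D U\<close> equals the stacked gradients of the regularizer
(\<open>separable_program.stationary\<close>). The closed loop is therefore a linear system in feedback
with the static nonlinearity \<open>y\<^sub>h = \<nabla>l(u\<^sub>h)\<close>.

\<^bold>\<open>Contraction.\<close> The gradient of a convex \<open>L\<close>-smooth function is cocoercive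
(\<open>gradient_cocoercive\<close>): for two inputs \<open>u, u'\<close> with gradients \<open>y, y'\<close> one has
\<open>(u - u') \<bullet> (y - y') \<ge> |y - y'|\<^sup>2 / L\<close>. Written out on a pair of increments \<open>(x, U)\<close>, the matrix
inequality (\<open>mpc_lmi_iff\<close>) says that the decay \<open>|x\<^sup>+|\<^sub>P\<^sup>2 - \<eta>\<^sup>2 |x|\<^sub>P\<^sup>2\<close> plus the
multiplier-weighted sum \<open>\<Sum>\<^sub>h 2 \<lambda>\<^sub>h (u\<^sub>h \<bullet> y\<^sub>h - |y\<^sub>h|\<^sup>2 / L)\<close> is nonpositive. As the second part is
nonnegative along the closed loop, the first is nonpositive, which is the contraction
(\<open>lmi_imp_contracting\<close>).

\<^bold>\<open>Feasibility.\<close> If the spectral radius of the nominal closed-loop matrix is below \<open>\<eta>\<close>,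
there is a quadratic Lyapunov function \<open>P\<close> for it with rate \<open>\<eta>\<close> and strict decrease
(\<open>discrete_lyapunov\<close>). Let \<open>V = U + D\<^sup>-\<^sup>1 C x\<close> be the deviation from the unregularized optimizer. With
all multipliers equal to one, the quadratic form is bounded by
\<open>- \<alpha> |x|\<^sup>2 + 2 g |x| |V| + (k - 2 d\<^sup>2 / L) |V|\<^sup>2\<close> with constants independent of \<open>L\<close>, and a small
enough \<open>L\<close> makes this nonpositive (\<open>lmi_feasible\<close>).

The Lyapunov function rests on the decay \<open>A\<^sup>k / r\<^sup>k \<rightarrow> 0\<close> for \<open>r\<close> above the spectral radius
(\<open>orbit_decay\<close>). The entries of the resolvent vector \<open>(1 - w A)\<^sup>-\<^sup>1 b\<close> are quotients of determinants by
Cramer's rule, hence holomorphic where the determinant does not vanish; their Taylor coefficients are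
the entries of \<open>A\<^sup>k b\<close>, and the Taylor series converges at \<open>w = 1/r\<close>.
\<close>

section \<open>Adjoints, bounds and stacked vectors\<close>

lemma inner_transpose_left: "(transpose M *v x) \<bullet> y = x \<bullet> (M *v y)" for M :: "real^'n^'m"
  by (simp add: dot_lmul_matrix)

lemma inner_transpose_right: "x \<bullet> (transpose M *v y) = (M *v x) \<bullet> y" for M :: "real^'n^'m"
  by (metis inner_transpose_left inner_commute)

lemma inner_congruence:
  "x \<bullet> ((transpose X ** N ** Y) *v y) = (X *v x) \<bullet> (N *v (Y *v y))" for N :: "real^'n^'m"
  by (simp only: matrix_vector_mul_assoc[symmetric] inner_transpose_right)

lemma inner_sym_matrix: "sym_matrix M \<Longrightarrow> x \<bullet> (M *v y) = (M *v x) \<bullet> y"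
  by (metis inner_transpose_left sym_matrix_def)

lemma matrix_vector_bound:
  fixes M :: "'a::{euclidean_space,real_algebra_1}^'n^'m"
  obtains K where "K > 0" "\<And>v. norm (M *v v) \<le> K * norm v"
  using bounded_linear.pos_bounded[OF matrix_vector_mul_bounded_linear[of M]]
  by (metis mult.commute)

lemma inner_blk: "U \<bullet> V = (\<Sum>h\<in>UNIV. blk U h \<bullet> blk V h)"
  by (simp add: inner_vec_def blk_def sum.cartesian_product UNIV_Times_UNIV[symmetric] del: UNIV_Times_UNIV)

lemma blk_linear: "linear (\<lambda>U. blk U h)"
  by (rule linearI) (simp_all add: blk_def vec_eq_iff)

lemmas blk_simps = linear_add[OF blk_linear] linear_diff[OF blk_linear] linear_neg[OF blk_linear]
  linear_0[OF blk_linear] linear_cmul[OF blk_linear]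

definition stack :: "('h::finite \<Rightarrow> real^'m) \<Rightarrow> real^('h \<times> 'm)" where
  "stack v = (\<chi> p. v (fst p) $ snd p)"

lemma blk_stack [simp]: "blk (stack v) h = v h"
  by (simp add: blk_def stack_def vec_eq_iff)

lemma blk_eqI: "(\<And>h. blk U h = blk V h) \<Longrightarrow> U = V"
  by (auto simp: blk_def vec_eq_iff)

section \<open>The matrix inequality as a quadratic form\<close>

definition vec_join :: "real^'a \<Rightarrow> real^'b \<Rightarrow> real^('a + 'b)" where
  "vec_join x y = (\<chi> p. case p of Inl i \<Rightarrow> x $ i | Inr j \<Rightarrow> y $ j)"

lemma vec_join_cases:
  obtains x y where "v = vec_join x y"
proof
  show "v = vec_join (\<chi> i. v $ Inl i) (\<chi> j. v $ Inr j)"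
    by (auto simp: vec_join_def vec_eq_iff split: sum.split)
qed

lemma sum_UNIV_Plus: "sum f (UNIV :: ('a::finite + 'b::finite) set) = (\<Sum>i\<in>UNIV. f (Inl i)) + (\<Sum>j\<in>UNIV. f (Inr j))"
  using sum.Plus[of "UNIV :: 'a set" "UNIV :: 'b set" f] by (simp add: o_def)

lemma inner_vec_join: "vec_join x y \<bullet> vec_join x' y' = x \<bullet> x' + y \<bullet> y'"
  by (simp add: inner_vec_def sum_UNIV_Plus vec_join_def)

lemma block2_vec_join:
  "block2 M11 M12 M21 M22 *v vec_join x y = vec_join (M11 *v x + M12 *v y) (M21 *v x + M22 *v y)"
  by (auto simp: block2_def vec_join_def matrix_vector_mult_def vec_eq_iff sum_UNIV_Plus split: sum.split)

lemma transpose_block2: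
  "transpose (block2 M11 M12 M21 M22) = block2 (transpose M11) (transpose M21) (transpose M12) (transpose M22)"
  by (auto simp: block2_def transpose_def vec_eq_iff split: sum.split)

lemma Lambda_mult_vector: "blk (Lambda l *v y) h = l $ h *\<^sub>R blk y h"
proof -
  have "(Lambda l *v y) $ p = l $ fst p * y $ p" for p
  proof -
    have "(Lambda l *v y) $ p = (\<Sum>q\<in>UNIV. if q = p then l $ fst p * y $ p else 0)"
      unfolding matrix_vector_mult_def Lambda_def kron_def diag_matrix_def mat_def
      by (auto intro!: sum.cong simp: prod_eq_iff)
    then show ?thesis by simp
  qed
  then show ?thesis by (simp add: blk_def vec_eq_iff)
qed

lemma inner_Lambda: "U \<bullet> (Lambda l *v y) = (\<Sum>h\<in>UNIV. l $ h * (blk U h \<bullet> blk y h))"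
  by (simp add: inner_blk Lambda_mult_vector)

lemma transpose_Lambda: "transpose (Lambda l) = Lambda l"
  by (auto simp: transpose_def Lambda_def kron_def diag_matrix_def mat_def vec_eq_iff)

lemma transpose_add: "transpose (M + N) = transpose M + transpose N"
  by (simp add: transpose_def vec_eq_iff)

lemma transpose_scaleR_minus: "transpose (- (c *\<^sub>R M)) = - (c *\<^sub>R transpose M)" for M :: "real^'n^'m"
  by (simp add: transpose_def vec_eq_iff)

lemma transpose_zero_matrix: "transpose 0 = (0 :: real^'n^'m)"
  by (simp add: transpose_def vec_eq_iff)

lemma transpose_diff: "transpose (M - N) = transpose M - transpose N"
  by (simp add: transpose_def vec_eq_iff)

lemma transpose_scaleR: "transpose (c *\<^sub>R M) = (c *\<^sub>R transpose M)" for M :: "real^'n^'m"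
  by (simp add: transpose_def vec_eq_iff)

lemma matrix_vector_mult_minus_left: "(- M) *v v = - (M *v v)" for M :: "real^'n^'m"
  by (simp add: vec_eq_iff matrix_vector_mult_def sum_negf)

text \<open>
The block matrices unfolded on a vector \<open>(x, U)\<close>: the first summand yields the quadratic form of
\<open>P\<close> at the successor state, and the second one only depends on \<open>U\<close> and \<open>y = - C x - D U\<close>, since the
outer factor maps \<open>(x, U)\<close> to \<open>(U, y)\<close>.
\<close>
lemma mpc_lmi_iff:
  fixes A :: "real^'n^'n" and B :: "real^'m^'n"
    and C :: "real^'n^('h::{finite,linorder} \<times> 'm)" and D :: "real^('h \<times> 'm)^('h \<times> 'm)"
  assumes "sym_matrix P"
  shows "mpc_lmi A B C D \<eta> P l L \<longleftrightarrow>
    (\<forall>x U. sq_norm P (A *v x + B *v (Pi1 *v U)) - \<eta>\<^sup>2 * sq_norm P x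
        + 2 * (U \<bullet> (Lambda l *v (- (C *v x) - D *v U)))
        - 2 / L * ((- (C *v x) - D *v U) \<bullet> (Lambda l *v (- (C *v x) - D *v U))) \<le> 0)"
proof -
  let ?BP = "B ** (Pi1 :: real^('h \<times> 'm)^'m)"
  let ?M = "block2 0 (mat 1) (- C) (- D)"
  let ?S = "block2 (transpose A ** P ** A - \<eta>\<^sup>2 *\<^sub>R P) (transpose A ** P ** ?BP)
                   (transpose ?BP ** P ** A) (transpose ?BP ** P ** ?BP)"
  let ?N = "block2 0 (Lambda l) (Lambda l) (- (2 / L) *\<^sub>R Lambda l) :: real^(('h \<times> 'm) + ('h \<times> 'm))^(('h \<times> 'm) + ('h \<times> 'm))"
  have P: "transpose P = P" using assms by (simp add: sym_matrix_def)
  have "transpose ?S = ?S"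
    by (simp add: transpose_block2 transpose_diff transpose_scaleR matrix_transpose_mul P matrix_mul_assoc)
  moreover have "transpose ?N = ?N"
    by (simp add: transpose_block2 transpose_scaleR_minus transpose_Lambda transpose_zero_matrix)
  then have "transpose (transpose ?M ** ?N ** ?M) = transpose ?M ** ?N ** ?M"
    by (simp add: matrix_transpose_mul matrix_mul_assoc)
  ultimately have sym: "sym_matrix (?S + transpose ?M ** ?N ** ?M)"
    by (simp add: sym_matrix_def transpose_add)
  have form: "vec_join x U \<bullet> ((?S + transpose ?M ** ?N ** ?M) *v vec_join x U) =
      sq_norm P (A *v x + B *v (Pi1 *v U)) - \<eta>\<^sup>2 * sq_norm P x
        + 2 * (U \<bullet> (Lambda l *v (- (C *v x) - D *v U)))
        - 2 / L * ((- (C *v x) - D *v U) \<bullet> (Lambda l *v (- (C *v x) - D *v U)))" for x U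
  proof -
    define y where "y = - (C *v x) - D *v U"
    have My: "?M *v vec_join x U = vec_join U y"
      by (simp add: y_def block2_vec_join matrix_vector_mult_minus_left)
    have sy: "y \<bullet> (Lambda l *v U) = U \<bullet> (Lambda l *v y)"
      by (simp only: inner_Lambda) (simp add: inner_commute)
    have "vec_join x U \<bullet> ((transpose ?M ** ?N ** ?M) *v vec_join x U) =
        (?M *v vec_join x U) \<bullet> (?N *v (?M *v vec_join x U))"
      by (rule inner_congruence)
    also have "\<dots> = 2 * (U \<bullet> (Lambda l *v y)) - 2 / L * (y \<bullet> (Lambda l *v y))"
      unfolding My unfolding block2_vec_join inner_vec_join
      by (simp add: inner_add_right inner_diff_right sy scaleR_matrix_vector_assoc[symmetric] matrix_vector_mult_minus_left del: inner_minus_left)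
    finally have 2: "vec_join x U \<bullet> ((transpose ?M ** ?N ** ?M) *v vec_join x U) = \<dots>" .
    have 1: "vec_join x U \<bullet> (?S *v vec_join x U) = sq_norm P (A *v x + B *v (Pi1 *v U)) - \<eta>\<^sup>2 * sq_norm P x"
      unfolding block2_vec_join inner_vec_join
      by (simp add: inner_add_right inner_diff_right matrix_vector_mult_diff_rdistrib inner_congruence sq_norm_def
           scaleR_matrix_vector_assoc[symmetric] matrix_vector_mul_assoc[symmetric, of B Pi1] matrix_vector_right_distrib inner_add_left)
    show ?thesis
      unfolding matrix_vector_mult_add_rdistrib inner_add_right 1 2 y_def by simp
  qed
  show ?thesis
    unfolding mpc_lmi_def Let_def neg_semidef_def
    using sym form by (metis vec_join_cases)
qed

section \<open>Cocoercivity of gradients\<close>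

lemma GDERIV_line:
  assumes "GDERIV f (x + s *\<^sub>R v) :> g"
  shows "((\<lambda>t. f (x + t *\<^sub>R v)) has_real_derivative v \<bullet> g) (at s)"
proof -
  have "((\<lambda>t. x + t *\<^sub>R v) has_derivative (\<lambda>t. t *\<^sub>R v)) (at s)"
    by (auto intro!: derivative_eq_intros)
  from has_derivative_compose[OF this assms[unfolded gderiv_def]] show ?thesis
    by (simp add: has_field_derivative_def mult.commute[of _ "v \<bullet> g"])
qed

text \<open>
Reduces to the one-dimensional tangent inequality by restricting \<open>f\<close> to the line through \<open>x\<close>
and \<open>y\<close>.
\<close>
lemma convex_above_tangent:
  fixes f :: "'a::real_inner \<Rightarrow> real"
  assumes "convex_on UNIV f" "GDERIV f x :> g"
  shows "f x + (y - x) \<bullet> g \<le> f y"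
proof -
  let ?\<phi> = "\<lambda>t::real. f (x + t *\<^sub>R (y - x))"
  have "convex_on UNIV ?\<phi>"
  proof (rule convex_onI)
    fix u s t :: real assume u: "0 < u" "u < 1"
    have "x + ((1 - u) *\<^sub>R s + u *\<^sub>R t) *\<^sub>R (y - x) =
        (1 - u) *\<^sub>R (x + s *\<^sub>R (y - x)) + u *\<^sub>R (x + t *\<^sub>R (y - x))"
      by (simp add: algebra_simps)
    then show "?\<phi> ((1 - u) *\<^sub>R s + u *\<^sub>R t) \<le> (1 - u) * ?\<phi> s + u * ?\<phi> t"
      using convex_onD[OF assms(1), of u "x + s *\<^sub>R (y - x)" "x + t *\<^sub>R (y - x)"] u by simp
  qed simp
  moreover have "(?\<phi> has_real_derivative (y - x) \<bullet> g) (at 0)"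
    by (rule GDERIV_line) (simp add: assms)
  ultimately show ?thesis
    using convex_on_imp_above_tangent[of UNIV ?\<phi> 0 1 "(y - x) \<bullet> g"] by simp
qed

text \<open>
The descent lemma. The difference of the two sides along the segment from \<open>x\<close> to \<open>y\<close> is nonincreasing,
because the Lipschitz bound on the gradient controls its derivative.
\<close>
lemma descent_bound:
  fixes f :: "'a::real_inner \<Rightarrow> real"
  assumes g: "\<And>x. GDERIV f x :> g x" and lip: "L-lipschitz_on UNIV g"
  shows "f y \<le> f x + (y - x) \<bullet> g x + L / 2 * (norm (y - x))\<^sup>2"
proof -
  let ?v = "y - x"
  let ?\<phi> = "\<lambda>t. f (x + t *\<^sub>R ?v) - t * (?v \<bullet> g x) - L / 2 * (norm ?v)\<^sup>2 * t\<^sup>2"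
  have "?\<phi> 1 \<le> ?\<phi> 0"
  proof (rule DERIV_nonpos_imp_nonincreasing[of 0 1 ?\<phi>])
    fix t :: real assume t: "0 \<le> t" "t \<le> 1"
    have "(?\<phi> has_real_derivative ?v \<bullet> g (x + t *\<^sub>R ?v) - ?v \<bullet> g x - L * (norm ?v)\<^sup>2 * t) (at t)"
      by (auto intro!: derivative_eq_intros GDERIV_line[OF g])
    moreover have "?v \<bullet> (g (x + t *\<^sub>R ?v) - g x) \<le> norm ?v * norm (g (x + t *\<^sub>R ?v) - g x)"
      by (rule norm_cauchy_schwarz)
    moreover have "norm (g (x + t *\<^sub>R ?v) - g x) \<le> L * (t * norm ?v)"
      using lipschitz_onD[OF lip, of "x + t *\<^sub>R ?v" x] t by (simp add: dist_norm)
    then have "norm ?v * norm (g (x + t *\<^sub>R ?v) - g x) \<le> norm ?v * (L * (t * norm ?v))"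
      by (rule mult_left_mono) simp
    ultimately show "\<exists>y. (?\<phi> has_real_derivative y) (at t) \<and> y \<le> 0"
      by (intro exI[of _ "?v \<bullet> g (x + t *\<^sub>R ?v) - ?v \<bullet> g x - L * (norm ?v)\<^sup>2 * t"] conjI)
         (simp_all add: inner_diff_right power2_eq_square algebra_simps)
  qed simp
  then show ?thesis by simp
qed

text \<open>
The Baillon-Haddad inequality. A gradient step of length \<open>1/L\<close> from \<open>y\<close> along the difference of the
gradients, bounded below by the tangent at \<open>x\<close> and above by the descent lemma at \<open>y\<close>, sharpens the
tangent inequality by \<open>|g y - g x|\<^sup>2 / (2 L)\<close>; adding this to the same statement with \<open>x\<close> and \<open>y\<close>
exchanged cancels the function values.
\<close>
lemma gradient_cocoercive:
  fixes f :: "'a::real_inner \<Rightarrow> real"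
  assumes "convex_on UNIV f" and g: "\<And>x. GDERIV f x :> g x"
    and lip: "L-lipschitz_on UNIV g" and L: "L > 0"
  shows "(norm (g x - g y))\<^sup>2 / L \<le> (x - y) \<bullet> (g x - g y)"
proof -
  have half: "f x + (y - x) \<bullet> g x + (norm (g y - g x))\<^sup>2 / (2 * L) \<le> f y" for x y
  proof -
    let ?d = "g y - g x"
    let ?z = "y - (1 / L) *\<^sub>R ?d"
    have "f x + (?z - x) \<bullet> g x \<le> f ?z"
      by (rule convex_above_tangent) (use assms in auto)
    also have "\<dots> \<le> f y + (?z - y) \<bullet> g y + L / 2 * (norm (?z - y))\<^sup>2"
      by (rule descent_bound[OF g lip])
    finally have "f x + (y - x) \<bullet> g x - (1 / L) * (?d \<bullet> g x) \<le>
        f y - (1 / L) * (?d \<bullet> g y) + L / 2 * ((1 / L) * norm ?d)\<^sup>2"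
      using L by (simp add: inner_diff_left)
    moreover have "L / 2 * ((1 / L) * norm ?d)\<^sup>2 = (norm ?d)\<^sup>2 / (2 * L)"
      using L by (simp add: power2_eq_square field_simps)
    moreover have "(1 / L) * (?d \<bullet> g y) - (1 / L) * (?d \<bullet> g x) = 2 * ((norm ?d)\<^sup>2 / (2 * L))"
      using L by (simp add: power2_norm_eq_inner inner_diff_right field_simps)
    ultimately show ?thesis by linarith
  qed
  have "(norm (g x - g y))\<^sup>2 / L = (norm (g y - g x))\<^sup>2 / (2 * L) + (norm (g x - g y))\<^sup>2 / (2 * L)"
    using L by (simp add: norm_minus_commute field_simps)
  moreover have "(x - y) \<bullet> (g x - g y) = - ((y - x) \<bullet> g x) - ((x - y) \<bullet> g y)"
    by (simp add: algebra_simps)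
  ultimately show ?thesis using half[of x y] half[of y x] by linarith
qed

text \<open>
The constant is the minimum of the quadratic form on the unit sphere, which is compact.
\<close>
lemma pos_def_coercive:
  fixes D :: "real^'n^'n"
  assumes "pos_def D"
  obtains d where "d > 0" "\<And>v. d * (norm v)\<^sup>2 \<le> v \<bullet> (D *v v)"
proof -
  have cont: "continuous_on (sphere 0 1) (\<lambda>v::real^'n. v \<bullet> (D *v v))"
    by (intro continuous_intros)
  have "sphere (0::real^'n) 1 \<noteq> {}" by simp
  from continuous_attains_inf[OF _ this cont]
  obtain u :: "real^'n" where u: "norm u = 1" "\<And>v. norm v = 1 \<Longrightarrow> u \<bullet> (D *v u) \<le> v \<bullet> (D *v v)"
    by auto
  have "u \<noteq> 0" using u(1) by auto
  then have "0 < u \<bullet> (D *v u)" using assms by (auto simp: pos_def_def)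
  moreover have "u \<bullet> (D *v u) * (norm v)\<^sup>2 \<le> v \<bullet> (D *v v)" for v
  proof (cases "v = 0")
    case False
    have "u \<bullet> (D *v u) \<le> (v /\<^sub>R norm v) \<bullet> (D *v (v /\<^sub>R norm v))"
      by (rule u(2)) (use False in simp)
    also have "\<dots> = (v \<bullet> (D *v v)) / (norm v)\<^sup>2"
      by (simp add: matrix_vector_mult_scaleR power2_eq_square divide_simps)
    finally show ?thesis using False by (simp add: pos_le_divide_eq)
  qed simp
  ultimately show ?thesis using that by blast
qed

section \<open>Strongly convex separable programs\<close>

text \<open>
The common form of all control problems: the state enters only through the constant \<open>k\<close> and the
linear term \<open>c\<close>, so one analysis of the minimizer serves every state and every time.
\<close>
locale separable_program =
  fixes J :: "real^('h::finite \<times> 'm::finite) \<Rightarrow> real" and k :: real and c D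
    and f :: "'h \<Rightarrow> real^'m \<Rightarrow> real" and g L
  assumes J: "\<And>U. J U = k + U \<bullet> c + 1/2 * (U \<bullet> (D *v U)) + (\<Sum>h\<in>UNIV. f h (blk U h))"
    and D: "pos_def D"
    and convex: "\<And>h. convex_on UNIV (f h)"
    and grad: "\<And>h u. GDERIV (f h) u :> g h u"
    and lip: "\<And>h. L-lipschitz_on UNIV (g h)"
    and L: "L > 0"
begin

lemma gradient:
  "(J has_derivative (\<lambda>V. V \<bullet> (c + D *v U + stack (\<lambda>h. g h (blk U h))))) (at U)"
proof -
  have lin: "((\<lambda>U. blk U h) has_derivative (\<lambda>V. blk V h)) (at U)" for h
    by (intro bounded_linear_imp_has_derivative linear_conv_bounded_linear[THEN iffD1] blk_linear)
  have f: "((\<lambda>U. f h (blk U h)) has_derivative (\<lambda>V. blk V h \<bullet> g h (blk U h))) (at U)" for h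
    using has_derivative_compose[OF lin grad[unfolded gderiv_def]] .
  have D': "((*v) D has_derivative (*v) D) (at U)"
    by (intro bounded_linear_imp_has_derivative matrix_vector_mul_bounded_linear)
  have s: "U \<bullet> (D *v V) = V \<bullet> (D *v U)" for V
    using D inner_sym_matrix[of D U V] by (simp add: pos_def_def inner_commute)
  have "((\<lambda>U. k + U \<bullet> c + 1/2 * (U \<bullet> (D *v U)) + (\<Sum>h\<in>UNIV. f h (blk U h))) has_derivative
      (\<lambda>V. V \<bullet> c + 1/2 * (U \<bullet> (D *v V) + V \<bullet> (D *v U)) + (\<Sum>h\<in>UNIV. blk V h \<bullet> g h (blk U h)))) (at U)"
    by (rule derivative_eq_intros f D' refl | simp)+
  then show ?thesis
    by (simp add: J[abs_def] s inner_add_right inner_blk[of _ "stack _"])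
qed

text \<open>
The derivative vanishes at a minimizer; testing it in the direction of the gradient itself shows that
the gradient is zero.
\<close>
lemma stationary:
  assumes "is_arg_min J (\<lambda>_. True) U"
  shows "- c - D *v U = stack (\<lambda>h. g h (blk U h))"
proof -
  let ?w = "c + D *v U + stack (\<lambda>h. g h (blk U h))"
  have "(\<lambda>V. V \<bullet> ?w) = (\<lambda>V. 0)"
    by (rule differential_zero_maxmin[OF _ open_UNIV gradient])
       (use assms in \<open>auto simp: is_arg_min_def not_less\<close>)
  from fun_cong[OF this, of ?w] have "?w = 0" by simp
  then show ?thesis by (simp add: add_eq_0_iff algebra_simps)
qed

text \<open>
By the tangent inequality at \<open>0\<close> the convex summands are bounded below by an affine function, so the
coercive quadratic term dominates: outside a ball of radius \<open>r\<close> the value exceeds \<open>J 0\<close>, and inside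
the ball compactness applies.
\<close>
lemma minimizer_exists: "\<exists>U. is_arg_min J (\<lambda>_. True) U"
proof -
  obtain d where d: "d > 0" "\<And>v. d * (norm v)\<^sup>2 \<le> v \<bullet> (D *v v)"
    using pos_def_coercive[OF D] by blast
  let ?w = "c + stack (\<lambda>h. g h 0)"
  define r where "r = 2 * norm ?w / d"
  have lower: "J 0 - norm U * norm ?w + d / 2 * (norm U)\<^sup>2 \<le> J U" for U
  proof -
    have "(\<Sum>h\<in>UNIV. f h 0 + (blk U h - 0) \<bullet> g h 0) \<le> (\<Sum>h\<in>UNIV. f h (blk U h))"
      by (intro sum_mono convex_above_tangent convex grad)
    moreover have "- (U \<bullet> ?w) \<le> norm U * norm ?w"
      using Cauchy_Schwarz_ineq2[of U ?w] by linarith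
    ultimately show ?thesis
      using d(2)[of U] unfolding J
      by (simp add: sum.distrib inner_blk[of U "stack _"] blk_simps inner_add_right)
  qed
  have r: "0 \<le> r" using d(1) by (simp add: r_def)
  have "continuous_on (cball 0 r) J"
    by (meson gradient has_derivative_continuous continuous_at_imp_continuous_on)
  moreover have "cball 0 r \<noteq> {}" using r by simp
  ultimately obtain U where U: "U \<in> cball 0 r" "\<And>V. V \<in> cball 0 r \<Longrightarrow> J U \<le> J V"
    using continuous_attains_inf[OF compact_cball] by blast
  have "J U \<le> J V" for V
  proof (cases "V \<in> cball 0 r")
    case False
    have "J U \<le> J 0" using U r by simp
    moreover have "2 * norm ?w \<le> d * norm V"
      using False d by (simp add: r_def field_simps)
    then have "norm V * norm ?w \<le> d / 2 * (norm V)\<^sup>2"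
      using mult_left_mono[of "2 * norm ?w" "d * norm V" "norm V"]
      by (simp add: power2_eq_square algebra_simps)
    ultimately show ?thesis using lower[of V] by linarith
  qed (rule U)
  then show ?thesis by (auto simp: is_arg_min_linorder)
qed

lemma blocks_cocoercive:
  "(norm (g h u - g h v))\<^sup>2 / L \<le> (u - v) \<bullet> (g h u - g h v)"
  by (rule gradient_cocoercive[OF convex grad lip L])

text \<open>
Subtracting the stationarity conditions of two minimizers gives
\<open>\<Delta>U \<bullet> D \<Delta>U = - \<Sum>\<^sub>h \<Delta>u\<^sub>h \<bullet> \<Delta>g\<^sub>h\<close>, where the right-hand side is nonpositive because
gradients of convex functions are monotone.
\<close>
lemma minimizer_unique:
  assumes U: "is_arg_min J (\<lambda>_. True) U" and V: "is_arg_min J (\<lambda>_. True) V"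
  shows "U = V"
proof (rule ccontr)
  assume "U \<noteq> V"
  then have "0 < (U - V) \<bullet> (D *v (U - V))"
    using D by (simp add: pos_def_def)
  also have "D *v (U - V) = - (stack (\<lambda>h. g h (blk U h)) - stack (\<lambda>h. g h (blk V h)))"
    unfolding stationary[OF U, symmetric] stationary[OF V, symmetric]
    by (simp add: matrix_vector_mult_diff_distrib)
  also have "(U - V) \<bullet> \<dots> = - (\<Sum>h\<in>UNIV. (blk U h - blk V h) \<bullet> (g h (blk U h) - g h (blk V h)))"
    unfolding inner_minus_right inner_blk[of "U - V"] blk_simps blk_stack ..
  also have "\<dots> \<le> 0"
  proof -
    have "0 \<le> (u - v) \<bullet> (g h u - g h v)" for h u v
      using blocks_cocoercive[of h u v] L by (smt (verit) divide_nonneg_pos zero_le_power2)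
    then show ?thesis by (simp add: sum_nonneg)
  qed
  finally show False by simp
qed

lemma the_minimizer: "is_arg_min J (\<lambda>_. True) (THE U. is_arg_min J (\<lambda>_. True) U)"
  using minimizer_exists minimizer_unique by (metis theI')

end

section \<open>The cost as a function of the inputs\<close>

lemma matrix_pow_Suc_right: "matrix_pow A (Suc k) = matrix_pow A k ** A"
proof (induction k)
  case (Suc k)
  then show ?case by (simp add: matrix_pow_def matrix_mul_assoc)
qed (simp add: matrix_pow_def)

lemma matrix_pow_simps [simp]:
  "matrix_pow A 0 = mat 1" "matrix_pow A (Suc k) = A ** matrix_pow A k"
  by (simp_all add: matrix_pow_def)

lemma idx_le_iff: "idx h \<le> idx k \<longleftrightarrow> h \<le> k" for h k :: "'h::{finite,linorder}"
  by (metis idx_strict_mono leD le_less_linear less_imp_le order_le_less)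

lemma idx_bounds: "1 \<le> idx h" "idx h \<le> CARD('h)" for h :: "'h::{finite,linorder}"
  using bij_betw_idx bij_betwE by fastforce+

lemma idx_surj:
  assumes "1 \<le> k" "k \<le> CARD('h)"
  shows "\<exists>h :: 'h::{finite,linorder}. idx h = k"
  using bij_betw_imp_surj_on[OF bij_betw_idx[where 'h = 'h]] assms
  by (metis atLeastAtMost_iff imageE)

text \<open>
Variation of constants for the predicted states.
\<close>
lemma pred_state_eq:
  fixes U :: "real^('h::{finite,linorder} \<times> 'm::finite)"
  assumes "k \<le> CARD('h)"
  shows "pred_state A B x U (Suc k) = matrix_pow A k *v x
    + (\<Sum>j | idx j \<le> k. (matrix_pow A (k - idx j) ** B) *v blk U j)"
  using assms
proof (induction k)
  case 0
  have nonzero: "idx j \<noteq> 0" for j :: 'h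
    using idx_bounds(1)[of j] by linarith
  show ?case by (simp add: nonzero)
next
  case (Suc k)
  obtain j0 :: 'h where j0: "idx j0 = Suc k"
    using idx_surj[of "Suc k", where 'h = 'h] Suc.prems by auto
  have "idx j = Suc k \<longleftrightarrow> j = j0" for j
    using injD[OF inj_idx, of j j0] j0 by metis
  then have "{j :: 'h. idx j \<le> Suc k} = insert j0 {j. idx j \<le> k}"
    by (simp add: set_eq_iff le_Suc_eq disj_commute)
  moreover have "A *v (\<Sum>j | idx j \<le> k. (matrix_pow A (k - idx j) ** B) *v blk U j) =
      (\<Sum>j | idx j \<le> k. (matrix_pow A (Suc k - idx j) ** B) *v blk U j)"
    by (simp add: linear_sum[OF matrix_vector_mul_linear] matrix_vector_mul_assoc matrix_mul_assoc Suc_diff_le)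
  moreover have "stage (Suc k) = j0" by (metis j0 stage_idx)
  ultimately show ?case
    using Suc j0 by (simp add: matrix_vector_right_distrib matrix_vector_mul_assoc del: pred_state.simps(2))
      (simp add: matrix_vector_right_distrib matrix_vector_mul_assoc)
qed

lemma mult_vector_blockwise: "(M *v U) $ p = (\<Sum>j\<in>UNIV. \<Sum>r\<in>UNIV. M $ p $ (j, r) * U $ (j, r))"
  by (simp add: matrix_vector_mult_def sum.cartesian_product case_prod_beta UNIV_Times_UNIV[symmetric] del: UNIV_Times_UNIV)

lemma blk_Bbar: "blk (Bbar A B *v U) h = (\<Sum>j | j \<le> h. (matrix_pow A (idx h - idx j) ** B) *v blk U j)"
proof -
  have "(Bbar A B *v U) $ (h, i) = (\<Sum>j | j \<le> h. ((matrix_pow A (idx h - idx j) ** B) *v blk U j) $ i)" for i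
  proof -
    have "(Bbar A B *v U) $ (h, i) = (\<Sum>j\<in>UNIV. \<Sum>r\<in>UNIV. (if j \<le> h then (matrix_pow A (idx h - idx j) ** B) $ i $ r else 0) * U $ (j, r))"
      by (simp add: mult_vector_blockwise Bbar_def cong: if_cong)
    also have "\<dots> = (\<Sum>j\<in>UNIV. if j \<le> h then ((matrix_pow A (idx h - idx j) ** B) *v blk U j) $ i else 0)"
      by (intro sum.cong refl) (simp add: matrix_vector_mult_def blk_def)
    finally show ?thesis by (simp add: sum.If_cases)
  qed
  then show ?thesis by (simp add: vec_eq_iff blk_def)
qed

lemma blk_Abar: "blk (Abar A *v x) h = matrix_pow A (idx h) *v x"
  by (simp add: blk_def vec_eq_iff Abar_def matrix_vector_mult_def)

lemma pred_state_idx: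
  "pred_state A B x U (Suc (idx h)) = blk (Abar A *v x + Bbar A B *v U) h"
  for U :: "real^('h::{finite,linorder} \<times> 'm::finite)"
  by (simp add: pred_state_eq idx_bounds(2) blk_simps blk_Abar blk_Bbar idx_le_iff del: pred_state.simps)

lemma blk_block_diag: "blk (block_diag F *v U) h = F h *v blk U h"
proof -
  have "(block_diag F *v U) $ (h, i) = (F h *v blk U h) $ i" for i
  proof -
    have "(block_diag F *v U) $ (h, i) = (\<Sum>j\<in>UNIV. \<Sum>r\<in>UNIV. (if h = j then F h $ i $ r else 0) * U $ (j, r))"
      by (simp add: mult_vector_blockwise block_diag_def cong: if_cong)
    also have "\<dots> = (\<Sum>j\<in>UNIV. if j = h then (F h *v blk U h) $ i else 0)"
      by (intro sum.cong refl) (auto simp: matrix_vector_mult_def blk_def)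
    finally show ?thesis by simp
  qed
  then show ?thesis by (simp add: vec_eq_iff blk_def)
qed

lemma sq_norm_block_diag: "U \<bullet> (block_diag F *v U) = (\<Sum>h\<in>UNIV. sq_norm (F h) (blk U h))"
  by (simp add: inner_blk blk_block_diag sq_norm_def)

lemma sum_idx: "(\<Sum>h\<in>UNIV. F (idx (h :: 'h::{finite,linorder}))) = sum F {1..CARD('h)}"
  by (rule sum.reindex_bij_betw[OF bij_betw_idx])

text \<open>
The stage cost charges the states with numbers \<open>1, ..., H\<close>, whereas the stacked prediction consists of
those with numbers \<open>2, ..., H + 1\<close>. Re-indexing splits off the initial state, which does not depend on
the inputs, and moves the terminal weight to the last block.
\<close>
lemma state_cost_shift:
  fixes U :: "real^('h::{finite,linorder} \<times> 'm::finite)"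
  shows "(\<Sum>h\<in>(UNIV::'h set). sq_norm Q (pred_state A B x U (idx h))) + sq_norm Qf (pred_state A B x U (CARD('h) + 1))
    = sq_norm Q x + (\<Sum>h\<in>(UNIV::'h set). sq_norm (if idx h = CARD('h) then Qf else Q) (pred_state A B x U (Suc (idx h))))"
proof -
  obtain n where n: "CARD('h) = Suc n"
    using gr0_implies_Suc[OF finite_UNIV_card_ge_0[where 'a = 'h]] by auto
  let ?s = "pred_state A B x U"
  have peel: "sum s {1..Suc n} = s 1 + (\<Sum>k=1..n. s (Suc k))" for s :: "nat \<Rightarrow> real"
    by (induction n) auto
  have "(\<Sum>h\<in>(UNIV::'h set). sq_norm Q (?s (idx h))) = sq_norm Q (?s 1) + (\<Sum>k=1..n. sq_norm Q (?s (Suc k)))"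
    unfolding sum_idx[of "\<lambda>k. sq_norm Q (?s k)"] n by (rule peel)
  moreover have "(\<Sum>h\<in>(UNIV::'h set). sq_norm (if idx h = CARD('h) then Qf else Q) (?s (Suc (idx h)))) =
      (\<Sum>k=1..n. sq_norm Q (?s (Suc k))) + sq_norm Qf (?s (Suc (Suc n)))"
    unfolding sum_idx[of "\<lambda>k. sq_norm (if k = CARD('h) then Qf else Q) (?s (Suc k))"] unfolding n
    by (simp del: pred_state.simps)
  ultimately show ?thesis by (simp add: n del: pred_state.simps(2)) simp
qed

lemma sym_matrix_Qbar:
  assumes "sym_matrix Q" "sym_matrix Qf"
  shows "sym_matrix (Qbar Q Qf)"
proof -
  have "Q $ i $ j = Q $ j $ i" "Qf $ i $ j = Qf $ j $ i" for i j
    using assms by (auto simp: sym_matrix_def transpose_def vec_eq_iff)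
  then show ?thesis
    by (auto simp: sym_matrix_def transpose_def vec_eq_iff Qbar_def block_diag_def)
qed

lemma ocp_cost_eq:
  fixes A :: "real^'n^'n" and U :: "real^('h::{finite,linorder} \<times> 'm::finite)"
  assumes "sym_matrix Q" "sym_matrix Qf"
  shows "ocp_cost A B Q Qf R Vreg t x U =
    1/2 * (sq_norm Q x + sq_norm (Qbar Q Qf) (Abar A *v x :: real^('h \<times> 'n)))
    + U \<bullet> (Cmat A B Q Qf *v x) + 1/2 * (U \<bullet> (Dmat A B Q Qf R *v U)) + Vreg U t"
proof -
  let ?Q = "Qbar Q Qf :: real^('h \<times> 'n)^('h \<times> 'n)"
  let ?a = "Abar A *v x :: real^('h \<times> 'n)" and ?b = "Bbar A B *v U"
  have "(\<Sum>h\<in>(UNIV::'h set). sq_norm Q (pred_state A B x U (idx h))) + sq_norm Qf (pred_state A B x U (CARD('h) + 1))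
    = sq_norm Q x + (?a + ?b) \<bullet> (?Q *v (?a + ?b))"
    unfolding state_cost_shift pred_state_idx Qbar_def sq_norm_block_diag ..
  moreover have "(?a + ?b) \<bullet> (?Q *v (?a + ?b)) = sq_norm ?Q ?a + 2 * (U \<bullet> (Cmat A B Q Qf *v x)) + ?b \<bullet> (?Q *v ?b)"
  proof -
    have "?b \<bullet> (?Q *v ?a) = U \<bullet> (Cmat A B Q Qf *v x)"
      unfolding Cmat_def inner_congruence ..
    moreover have "?a \<bullet> (?Q *v ?b) = ?b \<bullet> (?Q *v ?a)"
      using inner_sym_matrix[OF sym_matrix_Qbar[OF assms]] by (metis inner_commute)
    ultimately show ?thesis
      by (simp add: matrix_vector_right_distrib inner_add_left inner_add_right sq_norm_def)
  qed
  moreover have "(\<Sum>h\<in>(UNIV::'h set). sq_norm R (blk U h)) + ?b \<bullet> (?Q *v ?b) = U \<bullet> (Dmat A B Q Qf R *v U)"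
    unfolding Dmat_def matrix_vector_mult_add_rdistrib inner_add_right inner_congruence Rbar_def sq_norm_block_diag ..
  ultimately show ?thesis
    unfolding ocp_cost_def sum.distrib by argo
qed

section \<open>Contraction of the closed loop\<close>

text \<open>
The matrix inequality is evaluated at the increments of state and optimal input between two arbitrary
states at the same time. The increment of \<open>- C x - D U\<close> is then an increment of gradients, so each
multiplier term is nonnegative by cocoercivity and can be dropped.
\<close>
lemma lmi_imp_contracting:
  fixes A :: "real^'n^'n" and B :: "real^'m^'n"
    and C :: "real^'n^('h::{finite,linorder} \<times> 'm)"
    and D :: "real^('h \<times> 'm)^('h \<times> 'm)"
  assumes sym: "sym_matrix Q" "sym_matrix Qf"
    and C: "C = Cmat A B Q Qf" and D: "D = Dmat A B Q Qf R" and pdD: "pos_def D"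
    and L: "L > 0"
    and conv: "\<And>t. convex_on UNIV (\<lambda>u. lreg u t)"
    and smooth: "\<And>t. L_smooth L (\<lambda>u. lreg u t)"
    and \<eta>: "0 < \<eta>" "\<eta> < 1"
    and P: "pos_def P" and l: "\<And>h. 0 \<le> l $ h" and lmi: "mpc_lmi A B C D \<eta> P l L"
  shows "strongly_contracting (mpc_closed_loop A B Q Qf R (separable_reg lreg :: real^('h \<times> 'm) \<Rightarrow> nat \<Rightarrow> real)) P \<eta>"
proof -
  obtain g where grad: "\<And>t u. GDERIV (\<lambda>u. lreg u t) u :> g t u" and lip: "\<And>t. L-lipschitz_on UNIV (g t)"
    using smooth unfolding L_smooth_def by metis
  let ?F = "mpc_closed_loop A B Q Qf R (separable_reg lreg :: real^('h \<times> 'm) \<Rightarrow> nat \<Rightarrow> real)"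
  have step: "weighted_norm P (?F t x - ?F t y) \<le> \<eta> * weighted_norm P (x - y)" for t x y
  proof -
    define J where "J z = ocp_cost A B Q Qf R (separable_reg lreg :: real^('h \<times> 'm) \<Rightarrow> nat \<Rightarrow> real) t z" for z
    define Us where "Us z = (ocp_solution A B Q Qf R (separable_reg lreg) t z :: real^('h \<times> 'm))" for z
    have sp: "separable_program (J z)
        (1/2 * (sq_norm Q z + sq_norm (Qbar Q Qf) (Abar A *v z :: real^('h \<times> 'n)))) (C *v z) D
        (\<lambda>h u. lreg u (t + idx h)) (\<lambda>h. g (t + idx h)) L" for z
      by unfold_locales
         (use conv grad lip L pdD in \<open>simp_all add: J_def ocp_cost_eq[OF sym] C D separable_reg_def\<close>)
    have Us: "- (C *v z) - D *v Us z = stack (\<lambda>h. g (t + idx h) (blk (Us z) h))" for z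
      unfolding Us_def ocp_solution_def J_def[symmetric]
      by (rule separable_program.stationary[OF sp separable_program.the_minimizer[OF sp]])
    define dx where "dx = x - y"
    define dU where "dU = Us x - Us y"
    define dy where "dy = - (C *v dx) - D *v dU"
    have dy: "dy = (- (C *v x) - D *v Us x) - (- (C *v y) - D *v Us y)"
      by (simp add: dy_def dx_def dU_def matrix_vector_mult_diff_distrib)
    have "0 \<le> 2 * (dU \<bullet> (Lambda l *v dy)) - 2 / L * (dy \<bullet> (Lambda l *v dy))"
    proof -
      have "2 * (dU \<bullet> (Lambda l *v dy)) - 2 / L * (dy \<bullet> (Lambda l *v dy)) =
          2 * (\<Sum>h\<in>UNIV. l $ h * (blk dU h \<bullet> blk dy h - (norm (blk dy h))\<^sup>2 / L))"
        by (simp add: inner_Lambda power2_norm_eq_inner sum_subtractf right_diff_distrib sum_divide_distrib[symmetric])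
      moreover have "(norm (blk dy h))\<^sup>2 / L \<le> blk dU h \<bullet> blk dy h" for h
        unfolding dy Us blk_simps blk_stack dU_def
        by (rule separable_program.blocks_cocoercive[OF sp])
      ultimately show ?thesis
        using l by (simp add: sum_nonneg)
    qed
    moreover have "sq_norm P (A *v dx + B *v (Pi1 *v dU)) - \<eta>\<^sup>2 * sq_norm P dx
        + 2 * (dU \<bullet> (Lambda l *v dy)) - 2 / L * (dy \<bullet> (Lambda l *v dy)) \<le> 0"
      using lmi P unfolding dy_def by (subst (asm) mpc_lmi_iff) (auto simp: pos_def_def)
    ultimately have "sq_norm P (A *v dx + B *v (Pi1 *v dU)) \<le> \<eta>\<^sup>2 * sq_norm P dx"
      by linarith
    moreover have "?F t x - ?F t y = A *v dx + B *v (Pi1 *v dU)"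
      by (simp add: mpc_closed_loop_def dx_def dU_def Us_def matrix_vector_mult_diff_distrib)
    ultimately have "sqrt (sq_norm P (?F t x - ?F t y)) \<le> sqrt (\<eta>\<^sup>2 * sq_norm P dx)"
      by (simp add: real_sqrt_le_mono)
    then show ?thesis
      using \<eta> by (simp add: weighted_norm_def real_sqrt_mult dx_def)
  qed
  then show ?thesis
    using P \<eta> by (simp add: strongly_contracting_def trajectory_def)
qed

section \<open>Spectral radius and Lyapunov functions\<close>

text \<open>
Stated over the complex numbers because the resolvent argument takes place there; a real matrix enters
through its entrywise embedding.
\<close>
definition eigenvalue :: "complex^'n^'n \<Rightarrow> complex \<Rightarrow> bool" where
  "eigenvalue M z \<longleftrightarrow> (\<exists>v. v \<noteq> 0 \<and> M *v v = z *s v)"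

lemma mat_mult_vector: "mat z *v v = z *s v" for v :: "complex^'n"
  by (simp add: vec_eq_iff matrix_vector_mult_def mat_def if_distrib if_distribR sum.delta cong: if_cong)

lemma norm_vector_smult: "norm (z *s v) = norm z * norm v" for v :: "complex^'n"
  by (simp add: norm_vec_def norm_mult L2_set_right_distrib)

lemma eigenvalue_iff_det: "eigenvalue M z \<longleftrightarrow> det (mat z - M) = 0"
proof -
  have "det (mat z - M) \<noteq> 0 \<longleftrightarrow> (\<forall>v. (mat z - M) *v v = 0 \<longrightarrow> v = 0)"
    by (metis invertible_det_nz invertible_left_inverse matrix_left_invertible_ker)
  then show ?thesis
    by (auto simp: eigenvalue_def matrix_vector_mult_diff_rdistrib mat_mult_vector)
qed

lemma holomorphic_on_det:
  assumes "\<And>i j. (\<lambda>w. F w $ i $ j) holomorphic_on S"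
  shows "(\<lambda>w. det (F w :: complex^'n^'n)) holomorphic_on S"
  unfolding det_def by (intro holomorphic_intros assms)

text \<open>
Cramer's rule writes the entries of the solution as quotients of determinants.
\<close>
lemma solution_holomorphic:
  fixes F :: "complex \<Rightarrow> complex^'n^'n"
  assumes hol: "\<And>i j. (\<lambda>w. F w $ i $ j) holomorphic_on S"
    and nz: "\<And>w. w \<in> S \<Longrightarrow> det (F w) \<noteq> 0"
  shows "\<exists>x. (\<forall>i. (\<lambda>w. x w $ i) holomorphic_on S) \<and> (\<forall>w\<in>S. F w *v x w = b)"
proof -
  define x where "x w = (\<chi> k. det (\<chi> i j. if j = k then b $ i else F w $ i $ j) / det (F w))" for w
  have "F w *v x w = b" if "w \<in> S" for w
    using cramer[OF nz[OF that], of "x w" b] by (simp add: x_def)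
  moreover have "(\<lambda>w. x w $ i) holomorphic_on S" for i
    unfolding x_def vec_lambda_beta
  proof (intro holomorphic_on_divide holomorphic_on_det hol nz)
    show "(\<lambda>w. (\<chi> r j. if j = i then b $ r else F w $ r $ j) $ r $ j) holomorphic_on S" for r j
      using hol[of r j] by (cases "j = i") simp_all
  qed
  ultimately show ?thesis by blast
qed

lemma holomorphic_charmatrix: "(\<lambda>z. (mat z - M) $ i $ j) holomorphic_on S" for M :: "complex^'n^'n"
  by (cases "i = j") (auto simp: mat_def intro!: holomorphic_intros)

lemma eigenvalue_norm_le:
  assumes "\<And>v. norm (M *v v) \<le> K * norm v" "eigenvalue M z"
  shows "norm z \<le> K"
proof -
  obtain v where v: "v \<noteq> 0" "M *v v = z *s v"
    using assms(2) by (auto simp: eigenvalue_def)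
  have "norm z * norm v \<le> K * norm v"
    using assms(1)[of v] v by (simp add: norm_vector_smult)
  then show ?thesis using v by simp
qed

text \<open>
Together with \<open>eigenvalue_exists\<close> this makes the maximum in the definition of the spectral radius
meaningful. The eigenvalues are the zeros of an entire function and lie in a disc, so there can be
infinitely many only if the function is constant; a constant value cannot be zero since
the zeros are bounded.
\<close>
lemma finite_eigenvalues: "finite {z. eigenvalue (M :: complex^'n^'n) z}"
proof -
  obtain K where K: "K > 0" "\<And>v. norm (M *v v) \<le> K * norm v"
    using matrix_vector_bound[of M] by blast
  let ?f = "\<lambda>z. det (mat z - M)"
  have hol: "?f holomorphic_on UNIV"
    by (intro holomorphic_on_det holomorphic_charmatrix)
  have bd: "norm z \<le> K" if "?f z = 0" for z
    using eigenvalue_norm_le[OF K(2)] that by (simp add: eigenvalue_iff_det)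
  show ?thesis
  proof (cases "?f constant_on UNIV")
    case True
    then obtain c where c: "\<And>z. ?f z = c" by (auto simp: constant_on_def)
    have "c \<noteq> 0"
      using bd[of "of_real (K + 1)"] c K(1) by (force simp del: of_real_add)
    then show ?thesis by (simp add: eigenvalue_iff_det c)
  next
    case False
    have "finite {z \<in> cball 0 K. ?f z = 0}"
      by (rule holomorphic_compact_finite_zeros[OF hol _ _ _ _ False]) auto
    also have "{z \<in> cball 0 K. ?f z = 0} = {z. eigenvalue M z}"
      using bd by (auto simp: eigenvalue_iff_det)
    finally show ?thesis .
  qed
qed

text \<open>
Without eigenvalues the resolvent applied to a nonzero vector would be entire and vanish at infinity,
hence be zero by Liouville's theorem.
\<close>
lemma eigenvalue_exists: "\<exists>z. eigenvalue (M :: complex^'n^'n) z"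
proof (rule ccontr)
  assume none: "\<nexists>z. eigenvalue M z"
  obtain K where K: "K > 0" "\<And>v. norm (M *v v) \<le> K * norm v"
    using matrix_vector_bound[of M] by blast
  let ?b = "1 :: complex^'n"
  have nz: "det (mat z - M) \<noteq> 0" if "z \<in> UNIV" for z
    using none by (simp add: eigenvalue_iff_det)
  obtain x where x: "\<And>i. (\<lambda>z. x z $ i) holomorphic_on UNIV"
      and eq: "\<And>z. (mat z - M) *v x z = ?b"
    using solution_holomorphic[OF holomorphic_charmatrix nz, of UNIV ?b] by auto
  have bound: "norm (x z) \<le> norm ?b / (norm z - K)" if "norm z > K" for z
  proof -
    have "z *s x z = ?b + M *v x z"
      using eq[of z] by (simp add: matrix_vector_mult_diff_rdistrib mat_mult_vector algebra_simps)
    then have "norm z * norm (x z) = norm (?b + M *v x z)"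
      by (metis norm_vector_smult)
    also have "\<dots> \<le> norm ?b + K * norm (x z)"
      using norm_triangle_ineq[of ?b "M *v x z"] K(2)[of "x z"] by linarith
    finally show ?thesis using that by (simp add: field_simps)
  qed
  have "x z $ i = 0" for z i
  proof (rule Liouville_weak_0[OF x])
    have "filterlim (\<lambda>z::complex. - K + norm z) at_top at_infinity"
      by (rule filterlim_tendsto_add_at_top[OF tendsto_const filterlim_norm_at_top])
    then have lim: "((\<lambda>z::complex. norm ?b / (norm z - K)) \<longlongrightarrow> 0) at_infinity"
      by (intro tendsto_divide_0[OF tendsto_const] filterlim_at_top_imp_at_infinity) simp
    have "norm (x z $ i) \<le> norm ?b / (norm z - K)" if "K + 1 \<le> norm z" for z
      using bound[of z] that Finite_Cartesian_Product.norm_nth_le[of "x z" i] by linarith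
    then have "eventually (\<lambda>z. norm (x z $ i) \<le> norm ?b / (norm z - K)) at_infinity"
      unfolding eventually_at_infinity by blast
    then show "((\<lambda>z. x z $ i) \<longlongrightarrow> 0) at_infinity"
      by (rule Lim_null_comparison[OF _ lim])
  qed
  then have "x 0 = 0" by (simp add: vec_eq_iff)
  with eq[of 0] show False by simp
qed

text \<open>
This is the part of Gelfand's spectral radius formula that is needed here. The solution of
\<open>x(w) = c\<^sub>0 + w M x(w)\<close> is holomorphic on every disc in which \<open>1 - w M\<close> is invertible.
Comparing Taylor coefficients in this equation shows that they satisfy the recurrence of the orbit, so
they are \<open>c\<^sub>k\<close>; the summands of the convergent series at \<open>w = 1/r\<close> tend to zero.
\<close>
lemma orbit_decay:
  fixes M :: "complex^'n^'n"
  assumes orb: "\<And>k. c (Suc k) = M *v c k"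
    and ev: "\<And>z. eigenvalue M z \<Longrightarrow> norm z \<le> s" and s: "0 \<le> s" "s < r"
  shows "(\<lambda>k. c k $ i / of_real r ^ k) \<longlonglongrightarrow> 0"
proof -
  \<comment> \<open>any radius strictly between \<open>1/r\<close> and \<open>1/s\<close> would do; this one also makes sense for \<open>s = 0\<close>\<close>
  define R where "R = 2 / (s + r)"
  have R: "0 < R" "1 / r < R"
    using s by (auto simp: R_def field_simps)
  let ?F = "\<lambda>w. mat 1 - (\<chi> i j. w * M $ i $ j)"
  have hol: "(\<lambda>w. ?F w $ i $ j) holomorphic_on ball 0 R" for i j
    by (auto simp: mat_def intro!: holomorphic_intros)
  have mult: "(\<chi> i j. w * M $ i $ j) *v v = w *s (M *v v)" for w v
    by (simp add: vec_eq_iff matrix_vector_mult_def sum_distrib_left mult.assoc)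
  have nz: "det (?F w) \<noteq> 0" if w: "w \<in> ball 0 R" for w
  proof
    assume "det (?F w) = 0"
    then have "\<not> (\<forall>v. ?F w *v v = 0 \<longrightarrow> v = 0)"
      by (metis invertible_det_nz invertible_left_inverse matrix_left_invertible_ker)
    then obtain v where v: "v \<noteq> 0" "v = w *s (M *v v)"
      by (auto simp: matrix_vector_mult_diff_rdistrib mult)
    then have w0: "w \<noteq> 0" by auto
    have "M *v v = (1 / w) *s v"
      using arg_cong[OF v(2), of "\<lambda>u. (1 / w) *s u"] w0 by (simp add: vector_smult_assoc)
    then have "eigenvalue M (1 / w)" using v by (auto simp: eigenvalue_def)
    then have "1 / norm w \<le> s" using ev by (force simp: norm_divide)
    moreover have "norm w * (s + r) < 2" 
      using w s by (simp add: R_def field_simps)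
    moreover have "1 \<le> s * norm w" using calculation(1) w0 by (simp add: field_simps)
    moreover have "s * norm w \<le> r * norm w" using s by (intro mult_right_mono) auto
    ultimately show False by (simp add: algebra_simps)
  qed
  have "\<exists>x. (\<forall>i. (\<lambda>w. x w $ i) holomorphic_on ball 0 R) \<and> (\<forall>w\<in>ball 0 R. ?F w *v x w = c 0)"
    by (rule solution_holomorphic[OF hol nz])
  then obtain x where x: "\<forall>i. (\<lambda>w. x w $ i) holomorphic_on ball 0 R"
      and eq: "\<forall>w\<in>ball 0 R. ?F w *v x w = c 0"
    by (elim exE conjE)
  define f where "f i = fps_expansion (\<lambda>w. x w $ i) 0" for i
  have f: "(\<lambda>w. x w $ i) has_fps_expansion f i" for i
    unfolding f_def by (rule has_fps_expansion_fps_expansion[OF _ _ x[rule_format]]) (use R in auto)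
  have rec: "f i = fps_const (c 0 $ i) + fps_X * (\<Sum>j\<in>UNIV. fps_const (M $ i $ j) * f j)" (is "_ = ?g") for i
  proof -
    have "(\<lambda>w. c 0 $ i + w * (\<Sum>j\<in>UNIV. M $ i $ j * x w $ j)) has_fps_expansion ?g"
      by (intro fps_expansion_intros f)
    moreover have "eventually (\<lambda>w. c 0 $ i + w * (\<Sum>j\<in>UNIV. M $ i $ j * x w $ j) = x w $ i) (nhds 0)"
    proof (rule eventually_mono[OF eventually_nhds_in_open[of "ball 0 R"]])
      fix w :: complex assume "w \<in> ball 0 R"
      then have "x w - w *s (M *v x w) = c 0"
        using eq by (simp add: matrix_vector_mult_diff_rdistrib mult)
      then have "x w $ i = (c 0 + w *s (M *v x w)) $ i"
        by (metis diff_add_cancel)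
      then show "c 0 $ i + w * (\<Sum>j\<in>UNIV. M $ i $ j * x w $ j) = x w $ i"
        by (simp add: matrix_vector_mult_def)
    qed (use R in auto)
    ultimately have "(\<lambda>w. x w $ i) has_fps_expansion ?g"
      unfolding has_fps_expansion_def by (auto elim: eventually_elim2)
    then show ?thesis
      using f[of i] by (intro fps_ext) (simp only: fps_nth_fps_expansion)
  qed
  have coeff: "fps_nth (f i) k = c k $ i" for i k
  proof (induction k arbitrary: i)
    case 0
    show ?case by (subst rec) simp
  next
    case (Suc k)
    show ?case by (subst rec) (simp add: fps_sum_nth Suc orb matrix_vector_mult_def)
  qed
  have "(\<lambda>k. (deriv ^^ k) (\<lambda>w. x w $ i) 0 / fact k * (of_real (1 / r) - 0) ^ k) sums x (of_real (1 / r)) $ i"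
    by (rule holomorphic_power_series[OF x[rule_format]]) (use R s in \<open>auto simp: norm_divide\<close>)
  then have "(\<lambda>k. fps_nth (f i) k * of_real (1 / r) ^ k) \<longlonglongrightarrow> 0"
    by (simp add: fps_nth_fps_expansion[OF f] sums_iff summable_LIMSEQ_zero)
  then show ?thesis
    by (simp add: coeff power_divide)
qed

lemma complex_eigenvalues_eq:
  "complex_eigenvalues A = {z. eigenvalue (\<chi> i j. complex_of_real (A $ i $ j)) z}"
  by (simp add: complex_eigenvalues_def eigenvalue_def)

lemma cmod_le_spec_radius: "z \<in> complex_eigenvalues A \<Longrightarrow> cmod z \<le> spec_radius A"
  by (simp add: spec_radius_def complex_eigenvalues_eq finite_eigenvalues)

lemma spec_radius_nonneg: "0 \<le> spec_radius A"
proof -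
  obtain z where "z \<in> complex_eigenvalues A"
    using eigenvalue_exists unfolding complex_eigenvalues_eq by blast
  then show ?thesis
    using cmod_le_spec_radius norm_ge_zero order_trans by blast
qed

lemma matrix_pow_decay:
  assumes "spec_radius A < r"
  shows "(\<lambda>k. matrix_pow A k $ i $ j / r ^ k) \<longlonglongrightarrow> 0"
proof -
  let ?M = "\<chi> i j. complex_of_real (A $ i $ j)"
  let ?c = "\<lambda>k. \<chi> i. complex_of_real (matrix_pow A k $ i $ j)"
  have "(\<lambda>k. ?c k $ i / of_real r ^ k) \<longlonglongrightarrow> 0"
  proof (rule orbit_decay)
    show "?c (Suc k) = ?M *v ?c k" for k
      by (simp add: vec_eq_iff matrix_vector_mult_def matrix_matrix_mult_def)
    show "cmod z \<le> spec_radius A" if "eigenvalue ?M z" for z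
      using that by (intro cmod_le_spec_radius) (simp add: complex_eigenvalues_eq)
  qed (use assms spec_radius_nonneg in auto)
  then have "(\<lambda>k. of_real (matrix_pow A k $ i $ j / r ^ k) :: complex) \<longlonglongrightarrow> of_real 0"
    by simp
  then show ?thesis by (rule iffD1[OF tendsto_of_real_iff])
qed

text \<open>
Finitely many entries tend to zero after scaling, so at some power all of them are small at once.
\<close>
lemma matrix_pow_half_contraction:
  fixes A :: "real^'n^'n"
  assumes "spec_radius A < r"
  obtains N where "N > 0" "\<And>v. norm (matrix_pow A N *v v) \<le> r ^ N / 2 * norm v"
proof -
  have r: "0 < r" using assms spec_radius_nonneg[of A] by linarith
  define e where "e = 1 / (2 * real CARD('n) * real CARD('n))"
  have "e > 0" by (simp add: e_def)
  then have "eventually (\<lambda>k. \<bar>matrix_pow A k $ i $ j / r ^ k\<bar> < e) sequentially" for i j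
    using tendstoD[OF matrix_pow_decay[OF assms]] by (force simp: dist_real_def)
  then have "eventually (\<lambda>k. \<forall>i j. \<bar>matrix_pow A k $ i $ j / r ^ k\<bar> < e) sequentially"
    by (intro eventually_all_finite)
  from eventually_conj[OF this eventually_gt_at_top[of 0]]
  obtain N where N: "N > 0" "\<And>i j. \<bar>matrix_pow A N $ i $ j / r ^ N\<bar> < e"
    by (auto simp: eventually_sequentially)
  have "\<bar>matrix_pow A N $ i $ j\<bar> \<le> e * r ^ N" for i j
    using N(2)[of i j] r by (simp add: field_simps abs_divide)
  then have "onorm ((*v) (matrix_pow A N)) \<le> real CARD('n) * real CARD('n) * (e * r ^ N)"
    by (rule onorm_le_matrix_component)
  also have "\<dots> = r ^ N / 2" by (simp add: e_def)
  finally have "norm (matrix_pow A N *v v) \<le> r ^ N / 2 * norm v" for v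
    using onorm[OF matrix_vector_mul_bounded_linear, of "matrix_pow A N" v]
    by (meson mult_right_mono norm_ge_zero order_trans)
  with N(1) show ?thesis using that by blast
qed

text \<open>
A finite section \<open>P = \<Sum>\<^sub>k\<^sub><\<^sub>N r\<^sup>-\<^sup>2\<^sup>k (A\<^sup>k)\<^sup>T A\<^sup>k\<close> of the usual series solution of the Lyapunov equation
suffices: in \<open>|A x|\<^sub>P\<^sup>2 - r\<^sup>2 |x|\<^sub>P\<^sup>2\<close> the sums telescope to
\<open>r\<^sup>2 (r\<^sup>-\<^sup>2\<^sup>N |A\<^sup>N x|\<^sup>2 - |x|\<^sup>2)\<close>, which is at most \<open>- 3/4 r\<^sup>2 |x|\<^sup>2\<close> if \<open>A\<^sup>N / r\<^sup>N\<close> halves the norm.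
\<close>
lemma discrete_lyapunov:
  fixes A :: "real^'n^'n"
  assumes "spec_radius A < r"
  obtains P \<alpha> where "pos_def P" "\<alpha> > 0"
    "\<And>x. sq_norm P (A *v x) - r\<^sup>2 * sq_norm P x \<le> - \<alpha> * (norm x)\<^sup>2"
proof -
  have r: "0 < r" using assms spec_radius_nonneg[of A] by linarith
  obtain N where N: "N > 0" "\<And>v. norm (matrix_pow A N *v v) \<le> r ^ N / 2 * norm v"
    using matrix_pow_half_contraction[OF assms] by blast
  define P where "P = (\<Sum>k<N. (1 / r\<^sup>2) ^ k *\<^sub>R (transpose (matrix_pow A k) ** matrix_pow A k))"
  define g where "g v k = (1 / r\<^sup>2) ^ k * (norm (matrix_pow A k *v v))\<^sup>2" for v k
  have P: "sq_norm P v = (\<Sum>k<N. g v k)" for v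
  proof -
    have "P *v v = (\<Sum>k<N. ((1 / r\<^sup>2) ^ k *\<^sub>R (transpose (matrix_pow A k) ** matrix_pow A k)) *v v)"
      unfolding P_def by (induction N) (simp_all add: matrix_vector_mult_add_rdistrib)
    moreover have "v \<bullet> ((transpose M ** M) *v v) = (norm (M *v v))\<^sup>2" for M :: "real^'n^'n"
      by (simp only: matrix_vector_mul_assoc[symmetric] inner_transpose_right power2_norm_eq_inner)
    ultimately show ?thesis
      by (simp add: sq_norm_def inner_sum_right g_def scaleR_matrix_vector_assoc[symmetric])
  qed
  have g0: "g v 0 = (norm v)\<^sup>2" for v by (simp add: g_def)
  have "sym_matrix P"
    by (simp add: sym_matrix_def P_def vec_eq_iff transpose_def matrix_matrix_mult_def mult.commute)
  moreover have "0 < sq_norm P v" if "v \<noteq> 0" for v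
  proof -
    have "g v 0 \<le> (\<Sum>k<N. g v k)"
      by (rule member_le_sum) (use N in \<open>auto simp: g_def\<close>)
    then show ?thesis using that by (simp add: P g0) (smt (verit) zero_less_norm_iff zero_less_power)
  qed
  ultimately have pd: "pos_def P" by (simp add: pos_def_def sq_norm_def)
  have "sq_norm P (A *v x) - r\<^sup>2 * sq_norm P x \<le> - (3/4 * r\<^sup>2) * (norm x)\<^sup>2" for x
  proof -
    have "g (A *v x) k = r\<^sup>2 * g x (Suc k)" for k
      using r by (simp add: g_def matrix_vector_mul_assoc matrix_pow_Suc_right[symmetric] del: matrix_pow_simps)
    then have "sq_norm P (A *v x) - r\<^sup>2 * sq_norm P x = r\<^sup>2 * (\<Sum>k<N. g x (Suc k) - g x k)"
      by (simp add: P sum_distrib_left sum_subtractf right_diff_distrib)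
    also have "\<dots> = r\<^sup>2 * (g x N - (norm x)\<^sup>2)"
      by (simp add: sum_lessThan_telescope g0)
    finally have eq: "sq_norm P (A *v x) - r\<^sup>2 * sq_norm P x = r\<^sup>2 * (g x N - (norm x)\<^sup>2)" .
    have "(norm (matrix_pow A N *v x))\<^sup>2 \<le> (r ^ N / 2 * norm x)\<^sup>2"
      using N(2) by (intro power_mono) auto
    also have "\<dots> = (r\<^sup>2) ^ N * ((norm x)\<^sup>2 / 4)"
      by (simp add: power_mult_distrib power_divide flip: power_mult) (simp add: mult.commute)
    finally have "g x N \<le> (norm x)\<^sup>2 / 4"
      using r by (simp add: g_def power_divide field_simps)
    then have "r\<^sup>2 * (g x N - (norm x)\<^sup>2) \<le> r\<^sup>2 * ((norm x)\<^sup>2 / 4 - (norm x)\<^sup>2)"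
      by (intro mult_left_mono) auto
    then show ?thesis unfolding eq by (simp add: algebra_simps)
  qed
  then show ?thesis using pd r by (intro that[of P "3/4 * r\<^sup>2"]) auto
qed

section \<open>Feasibility of the matrix inequality\<close>

lemma bilinear_bound:
  fixes M :: "real^'n^'m"
  obtains K where "K > 0" "\<And>v w. \<bar>v \<bullet> (M *v w)\<bar> \<le> K * norm v * norm w"
proof -
  obtain K where K: "K > 0" "\<And>v. norm (M *v v) \<le> K * norm v"
    using matrix_vector_bound[of M] by metis
  have "\<bar>v \<bullet> (M *v w)\<bar> \<le> K * norm v * norm w" for v w
    using order_trans[OF Cauchy_Schwarz_ineq2 mult_left_mono[OF K(2)[of w] norm_ge_zero[of v]]]
    by (simp add: mult.assoc mult.left_commute)
  with K(1) that show ?thesis by metis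
qed

lemma pos_def_inverse: "pos_def D \<Longrightarrow> D ** matrix_inv D = mat 1"
proof -
  assume D: "pos_def D"
  have "\<forall>v. D *v v = 0 \<longrightarrow> v = 0"
    using D unfolding pos_def_def by (metis inner_zero_right less_irrefl)
  then have "invertible D"
    using matrix_left_invertible_ker invertible_left_inverse by blast
  then show ?thesis unfolding invertible_def matrix_inv_def by (rule someI2_ex) blast
qed

text \<open>
In the coordinates \<open>x\<close> and \<open>V = U + D\<^sup>-\<^sup>1 C x\<close> the signal \<open>y\<close> is \<open>- D V\<close> and the successor state is
\<open>A\<^sub>n\<^sub>o\<^sub>m x + B \<Pi>\<^sub>1 V\<close>. Every term except \<open>- (2/L) |D V|\<^sup>2\<close> has a bound independent of \<open>L\<close>, and this one
dominates all contributions in \<open>V\<close> when \<open>L\<close> is small.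
\<close>
lemma lmi_feasible:
  fixes A :: "real^'n^'n" and B :: "real^'m^'n"
    and C :: "real^'n^('h::{finite,linorder} \<times> 'm)"
    and D :: "real^('h \<times> 'm)^('h \<times> 'm)"
  assumes D: "pos_def D" and \<eta>: "spec_radius (A_nom A B C D) < \<eta>"
  shows "\<exists>P L. pos_def P \<and> 0 < L \<and> mpc_lmi A B C D \<eta> P 1 L"
proof -
  let ?N = "A_nom A B C D" and ?E = "B ** (Pi1 :: real^('h \<times> 'm)^'m)" and ?K = "matrix_inv D ** C"
  obtain P \<alpha> where P: "pos_def P" and \<alpha>: "\<alpha> > 0"
    and lyap: "\<And>x. sq_norm P (?N *v x) - \<eta>\<^sup>2 * sq_norm P x \<le> - \<alpha> * (norm x)\<^sup>2"
    using discrete_lyapunov[OF \<eta>] by metis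
  have symP: "sym_matrix P" and symD: "sym_matrix D"
    using P D by (auto simp: pos_def_def)
  obtain d where d: "d > 0" "\<And>v. d * (norm v)\<^sup>2 \<le> v \<bullet> (D *v v)"
    using pos_def_coercive[OF D] by metis
  have dD: "d * norm v \<le> norm (D *v v)" for v
  proof (cases "v = 0")
    case False
    have "d * (norm v)\<^sup>2 \<le> norm v * norm (D *v v)"
      using d(2)[of v] norm_cauchy_schwarz[of v "D *v v"] by linarith
    then show ?thesis using False by (simp add: power2_eq_square)
  qed simp
  \<comment> \<open>\<open>k1\<close> and \<open>k2\<close> bound the cross term and the term quadratic in \<open>V\<close> at the successor state, \<open>k3\<close> the part of \<open>U \<bullet> y\<close> that involves \<open>x\<close>\<close>
  obtain k1 where k1: "k1 > 0" "\<And>v w. \<bar>v \<bullet> ((transpose ?N ** P ** ?E) *v w)\<bar> \<le> k1 * norm v * norm w"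
    using bilinear_bound[of "transpose ?N ** P ** ?E"] by metis
  obtain k2 where k2: "k2 > 0" "\<And>v w. \<bar>v \<bullet> ((transpose ?E ** P ** ?E) *v w)\<bar> \<le> k2 * norm v * norm w"
    using bilinear_bound[of "transpose ?E ** P ** ?E"] by metis
  obtain k3 where k3: "k3 > 0" "\<And>v w. \<bar>v \<bullet> (transpose C *v w)\<bar> \<le> k3 * norm v * norm w"
    using bilinear_bound[of "transpose C"] by metis
  define g where "g = k1 + k3"
  \<comment> \<open>chosen such that the form is bounded by the negative square \<open>- (\<alpha> |x| - g |V|)\<^sup>2 / \<alpha>\<close>\<close>
  define L where "L = 2 * d\<^sup>2 / (k2 + g\<^sup>2 / \<alpha>)"
  have k: "k2 + g\<^sup>2 / \<alpha> > 0"
    using k2(1) \<alpha> by (simp add: add_pos_nonneg)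
  then have L: "L > 0" using d(1) by (simp add: L_def)
  have Ld: "2 / L * d\<^sup>2 = k2 + g\<^sup>2 / \<alpha>"
    using d(1) k by (simp add: L_def)
  have "mpc_lmi A B C D \<eta> P 1 L"
    unfolding mpc_lmi_iff[OF symP]
  proof (intro allI)
    fix x :: "real^'n" and U :: "real^('h \<times> 'm)"
    define V where "V = U + ?K *v x"
    have DK: "D *v (?K *v x) = C *v x"
      by (simp add: matrix_vector_mul_assoc matrix_mul_assoc pos_def_inverse[OF D])
    have y: "- (C *v x) - D *v U = - (D *v V)"
      by (simp add: V_def matrix_vector_right_distrib DK)
    have Lam: "Lambda 1 *v w = w" for w :: "real^('h \<times> 'm)"
      by (rule blk_eqI) (simp add: Lambda_mult_vector)
    have next_state: "A *v x + B *v (Pi1 *v U) = ?N *v x + ?E *v V"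
      by (simp add: A_nom_def V_def matrix_vector_mult_diff_rdistrib matrix_vector_right_distrib
          matrix_vector_mul_assoc matrix_mul_assoc)
    have 1: "sq_norm P (?N *v x + ?E *v V) \<le> sq_norm P (?N *v x) + 2 * (k1 * norm x * norm V) + k2 * (norm V)\<^sup>2"
    proof -
      have "(?N *v x) \<bullet> (P *v (?E *v V)) \<le> k1 * norm x * norm V"
        using k1(2)[of x V] unfolding inner_congruence by linarith
      moreover have "sq_norm P (?E *v V) \<le> k2 * (norm V)\<^sup>2"
        using k2(2)[of V V] unfolding inner_congruence sq_norm_def by (simp add: power2_eq_square mult.assoc)
      moreover have "sq_norm P (?N *v x + ?E *v V) =
          sq_norm P (?N *v x) + 2 * ((?N *v x) \<bullet> (P *v (?E *v V))) + sq_norm P (?E *v V)"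
        using inner_sym_matrix[OF symP, of "?E *v V" "?N *v x"]
        by (simp add: sq_norm_def matrix_vector_right_distrib inner_add_left inner_add_right inner_commute)
      ultimately show ?thesis by linarith
    qed
    \<comment> \<open>as \<open>U = V - D\<^sup>-\<^sup>1 C x\<close> and \<open>D\<close> is symmetric, \<open>U \<bullet> D V = V \<bullet> D V - C x \<bullet> V\<close>, where \<open>V \<bullet> D V \<ge> 0\<close>\<close>
    have 2: "U \<bullet> (- (D *v V)) \<le> k3 * norm x * norm V"
    proof -
      have "U \<bullet> (D *v V) = V \<bullet> (D *v V) - (?K *v x) \<bullet> (D *v V)"
        by (simp add: V_def inner_add_left del: matrix_vector_mul_assoc)
      also have "(?K *v x) \<bullet> (D *v V) = x \<bullet> (transpose C *v V)"
        unfolding inner_sym_matrix[OF symD] DK inner_transpose_right ..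
      finally show ?thesis
        using k3(2)[of x V] d(2)[of V] d(1) by (smt (verit) inner_minus_right zero_le_mult_iff zero_le_power2)
    qed
    have 3: "2 / L * ((D *v V) \<bullet> (D *v V)) \<ge> (k2 + g\<^sup>2 / \<alpha>) * (norm V)\<^sup>2"
    proof -
      have "(d * norm V)\<^sup>2 \<le> (D *v V) \<bullet> (D *v V)"
        unfolding power2_norm_eq_inner[symmetric] by (intro power_mono dD) (use d(1) in simp)
      then have "2 / L * (d * norm V)\<^sup>2 \<le> 2 / L * ((D *v V) \<bullet> (D *v V))"
        using L by (intro mult_left_mono) auto
      then show ?thesis by (simp only: power_mult_distrib mult.assoc[symmetric] Ld)
    qed
    have 4: "- \<alpha> * (norm x)\<^sup>2 + 2 * g * norm x * norm V - g\<^sup>2 / \<alpha> * (norm V)\<^sup>2 \<le> 0"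
    proof -
      have "- \<alpha> * (norm x)\<^sup>2 + 2 * g * norm x * norm V - g\<^sup>2 / \<alpha> * (norm V)\<^sup>2 =
          - (\<alpha> * norm x - g * norm V)\<^sup>2 / \<alpha>"
        using \<alpha> by (simp add: power2_eq_square field_simps)
      then show ?thesis using \<alpha> by simp
    qed
    show "sq_norm P (A *v x + B *v (Pi1 *v U)) - \<eta>\<^sup>2 * sq_norm P x
        + 2 * (U \<bullet> (Lambda 1 *v (- (C *v x) - D *v U)))
        - 2 / L * ((- (C *v x) - D *v U) \<bullet> (Lambda 1 *v (- (C *v x) - D *v U))) \<le> 0"
      unfolding y Lam next_state
      using 1 2 3 4 lyap[of x] by (simp add: g_def algebra_simps)
  qed
  then show ?thesis using P L by blast
qed

theorem theorem1:
  fixes A :: "real^'n^'n" and B :: "real^'m^'n"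
    and Q Qf :: "real^'n^'n" and R :: "real^'m^'m"
    and C :: "real^'n^('h::{finite,linorder} \<times> 'm)"
    and D :: "real^('h \<times> 'm)^('h \<times> 'm)"
    and lreg :: "real^'m \<Rightarrow> nat \<Rightarrow> real"
    and Vreg :: "real^('h \<times> 'm) \<Rightarrow> nat \<Rightarrow> real"
    and L \<eta> :: real
  assumes "sym_matrix Q" and "sym_matrix Qf" and "sym_matrix R"
    and C: "C = Cmat A B Q Qf"
    and D: "D = Dmat A B Q Qf R"
    and "pos_def D"
    and Vreg: "Vreg = separable_reg lreg"
    and "L > 0"
    and "\<And>t. convex_on UNIV (\<lambda>u. lreg u t)"
    and "\<And>t. L_smooth L (\<lambda>u. lreg u t)"
    and "0 < \<eta>" and "\<eta> < 1"
  shows "(\<forall>(P :: real^'n^'n) (l :: real^('h::{finite,linorder})).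
            pos_def P \<and> (\<forall>h. 0 \<le> l $ h) \<and> mpc_lmi A B C D \<eta> P l L \<longrightarrow>
            strongly_contracting (mpc_closed_loop A B Q Qf R Vreg) P \<eta>) \<and>
         (schur_stable (A_nom A B C D) \<longrightarrow>
          (\<forall>\<eta>'. spec_radius (A_nom A B C D) < \<eta>' \<and> \<eta>' < 1 \<longrightarrow>
            (\<exists>(P :: real^'n^'n) (l :: real^('h::{finite,linorder})) (L' :: real).
               pos_def P \<and> (\<forall>h. 0 \<le> l $ h) \<and> 0 < L' \<and> mpc_lmi A B C D \<eta>' P l L')))"
proof (intro conjI allI impI)
  fix P :: "real^'n^'n" and l :: "real^('h::{finite,linorder})"
  assume "pos_def P \<and> (\<forall>h. 0 \<le> l $ h) \<and> mpc_lmi A B C D \<eta> P l L"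
  then show "strongly_contracting (mpc_closed_loop A B Q Qf R Vreg) P \<eta>"
    unfolding Vreg using assms by (intro lmi_imp_contracting[of Q Qf C A B D R L lreg \<eta> P l]) auto
next
  fix \<eta>'
  assume "spec_radius (A_nom A B C D) < \<eta>' \<and> \<eta>' < 1"
  then obtain P L' where "pos_def P" "0 < L'" "mpc_lmi A B C D \<eta>' P 1 L'"
    using lmi_feasible[OF \<open>pos_def D\<close>] by blast
  moreover have "\<forall>h :: 'h. 0 \<le> (1 :: real^_) $ h" by simp
  ultimately show "\<exists>(P :: real^'n^'n) (l :: real^('h::{finite,linorder})) (L' :: real).
      pos_def P \<and> (\<forall>h. 0 \<le> l $ h) \<and> 0 < L' \<and> mpc_lmi A B C D \<eta>' P l L'"
    by blast
qed

end
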